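(* Let $\mathcal{X}\in\{\mathcal{X}_c,\mathcal{X}_d\}$, $\mathcal{U}\in\{\mathcal{U}_c,\mathcal{U}_d\}$ and $\mathcal{Y}\in\{\mathcal{Y}_c,\mathcal{Y}_d\}$. If $K$ is polynomial in the input, then $$\text{Bounded-}1\text{-Adaptability}(\mathcal{X},\mathcal{U},\mathcal{Y})\ \le\ \text{Bounded-}K\text{-Adaptability}(\mathcal{X},\mathcal{U},\mathcal{Y}),$$ i.e. the former decision problem is polynomial-time many-one reducible to the latter.
   Context: An instance consists of rational data encoded in binary: a bound $R\in\mathbb{Z}_+$, vectors $a\in\mathbb{Q}^{m_x}$, $b\in\mathbb{Q}^{m_u}$, matrices $A\in\mathbb{Q}^{m_x\times n_x}$, $B\in\mathbb{Q}^{m_u\times n_u}$, $W\in\mathbb{Q}^{m_y\times n_y}$, and an $m_y\times n_x$ matrix $T(u)$ whose entries depend linearly on $u$ with rational coefficients. The sets are $\mathcal{X}_c=\{x\in[0,R]^{n_x}: Ax\le a\}$, $\mathcal{U}_c=\{u\in[0,R]^{n_u}: Bu\le b\}$, $\mathcal{Y}_c(x,u)=\{y\in[0,R]^{n_y}: T(u)x+Wy\le 0\}$, and their discrete counterparts are $\mathcal{X}_d=\mathcal{X}_c\cap\mathbb{Z}^{n_x}$, $\mathcal{U}_d=\mathcal{U}_c\cap\mathbb{Z}^{n_u}$, $\mathcal{Y}_d(x,u)=\mathcal{Y}_c(x,u)\cap\mathbb{Z}^{n_y}$. Bounded-$K$-Adaptability$(\mathcal{X},\mathcal{U},\mathcal{Y})$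 is the decision problem (for the chosen types of sets) $$\exists x\in\mathcal{X},\ y^1,\dots,y^K\in\mathbb{R}^{n_y}\ \ \forall u\in\mathcal{U}:\ \{y^1,\dots,y^K\}\cap\mathcal{Y}(x,u)\neq\emptyset\,?$$ Here $K$ is given by a function of the input, the function itself not being part of the input (constant $K$ is a special case). "$K$ is polynomial in the input" means that $K$ is bounded by a polynomial in the encoding length of the instance (this includes constant $K$). $P\le Q$ means that decision problem $P$ reduces to $Q$ by a polynomial-time many-one reduction. *)

theory Defs
  imports Complex_Main "HOL-Computational_Algebra.Polynomial" "Jordan_Normal_Form.Matrix"
begin

section \<open>Multi-tape Turing machines\<close>

text \<open>Tape symbols are the naturals below \<open>symbols M\<close>, with 0 as the blank. The working states are
  \<open>0, \<dots>, states M - 1\<close>, with 0 as the start state; the state \<open>states M\<close> is the halting state.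
  A transition maps the state and the list of scanned symbols to the next state and, for every
  tape, the symbol to be written and the head movement.\<close>

datatype head_move = Move_Left | Move_None | Move_Right

record turing_machine =
  tapes :: nat
  symbols :: nat
  states :: nat
  transition :: "nat \<Rightarrow> nat list \<Rightarrow> nat \<times> (nat \<times> head_move) list"

definition wf_tm :: "turing_machine \<Rightarrow> bool" where
  "wf_tm M \<longleftrightarrow> 2 \<le> tapes M \<and> 0 < symbols M \<and>
     (\<forall>q ss q' acts. q < states M \<and> length ss = tapes M \<and> set ss \<subseteq> {..<symbols M} \<and>
        transition M q ss = (q', acts) \<longrightarrow>
        q' \<le> states M \<and> length acts = tapes M \<and> fst ` set acts \<subseteq> {..<symbols M})"

text \<open>A tape is infinite in both directions; it is given by its contents and its head position.\<close>

type_synonym tape = "(int \<Rightarrow> nat) \<times> int"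
type_synonym config = "nat \<times> tape list"

fun move_offset :: "head_move \<Rightarrow> int" where
  "move_offset Move_Left = -1"
| "move_offset Move_None = 0"
| "move_offset Move_Right = 1"

fun act_on_tape :: "nat \<times> head_move \<Rightarrow> tape \<Rightarrow> tape" where
  "act_on_tape (s, d) (t, h) = (t(h := s), h + move_offset d)"

fun tm_step :: "turing_machine \<Rightarrow> config \<Rightarrow> config" where
  "tm_step M (q, ts) =
     (if q = states M then (q, ts)
      else let (q', acts) = transition M q (map (\<lambda>(t, h). t h) ts)
           in (q', map2 act_on_tape acts ts))"

definition word_contents :: "nat list \<Rightarrow> int \<Rightarrow> nat" where
  "word_contents w i = (if 0 \<le> i \<and> i < int (length w) then w ! nat i else 0)"

definition initial_config :: "turing_machine \<Rightarrow> nat list \<Rightarrow> config" where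
  "initial_config M w = (0, (word_contents w, 0) # replicate (tapes M - 1) (\<lambda>_. 0, 0))"

text \<open>The input is given on tape 0, the output is read off tape 1.\<close>

definition tm_computes :: "turing_machine \<Rightarrow> nat list \<Rightarrow> nat list \<Rightarrow> nat \<Rightarrow> bool" where
  "tm_computes M w v t \<longleftrightarrow> set w \<subseteq> {0<..<symbols M} \<and> set v \<subseteq> {0<..<symbols M} \<and>
     (\<exists>ts. (tm_step M ^^ t) (initial_config M w) = (states M, ts) \<and>
        fst (ts ! 1) = word_contents v)"


section \<open>Polynomial-time many-one reductions\<close>

record 'i decision_problem =
  instances :: "'i set"
  yes_instances :: "'i set"
  encoding :: "'i \<Rightarrow> nat list"

text \<open>Since halting configurations are fixed points of \<open>tm_step\<close>, the last argument of
  \<open>tm_computes\<close> is an upper bound on the running time.\<close>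

definition poly_time_reducible ::
    "'i decision_problem \<Rightarrow> 'j decision_problem \<Rightarrow> bool" (infix \<open>\<le>\<^sub>p\<close> 50) where
  "P \<le>\<^sub>p Q \<longleftrightarrow> (\<exists>f M p. wf_tm M \<and>
     (\<forall>I \<in> instances P. f I \<in> instances Q \<and>
        (I \<in> yes_instances P \<longleftrightarrow> f I \<in> yes_instances Q) \<and>
        tm_computes M (encoding P I) (encoding Q (f I)) (poly p (length (encoding P I)))))"


section \<open>Instances of bounded adaptability\<close>

text \<open>\<open>T_mats\<close> lists the coefficient matrices of the linear map
  \<open>T(u) = u\<^sub>0 T\<^sub>0 + \<dots> + u\<^sub>n\<^sub>-\<^sub>1 T\<^sub>n\<^sub>-\<^sub>1\<close>, where \<open>n\<close> is the dimension of \<open>u\<close>.\<close>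

record adapt_instance =
  R_bound :: nat
  A_mat :: "rat mat"
  a_vec :: "rat vec"
  B_mat :: "rat mat"
  b_vec :: "rat vec"
  W_mat :: "rat mat"
  T_mats :: "rat mat list"

definition n_x :: "adapt_instance \<Rightarrow> nat" where "n_x I = dim_col (A_mat I)"
definition n_u :: "adapt_instance \<Rightarrow> nat" where "n_u I = dim_col (B_mat I)"
definition n_y :: "adapt_instance \<Rightarrow> nat" where "n_y I = dim_col (W_mat I)"
definition m_y :: "adapt_instance \<Rightarrow> nat" where "m_y I = dim_row (W_mat I)"

definition wf_instance :: "adapt_instance \<Rightarrow> bool" where
  "wf_instance I \<longleftrightarrow>
     dim_vec (a_vec I) = dim_row (A_mat I) \<and>
     dim_vec (b_vec I) = dim_row (B_mat I) \<and>
     length (T_mats I) = n_u I \<and>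
     set (T_mats I) \<subseteq> carrier_mat (m_y I) (n_x I)"

text \<open>Numbers are written in binary, most significant bit first. Dimensions are written in unary,
  so that the length of the code of a matrix is at least the number of its rows, columns and
  entries.\<close>

abbreviation (input) Sym_0 :: nat where "Sym_0 \<equiv> 1"
abbreviation (input) Sym_1 :: nat where "Sym_1 \<equiv> 2"
abbreviation (input) Sym_minus :: nat where "Sym_minus \<equiv> 3"
abbreviation (input) Sym_slash :: nat where "Sym_slash \<equiv> 4"
abbreviation (input) Sym_end :: nat where "Sym_end \<equiv> 5"

fun encode_nat :: "nat \<Rightarrow> nat list" where
  "encode_nat n =
     (if n < 2 then [] else encode_nat (n div 2)) @ [if even n then Sym_0 else Sym_1]"

declare encode_nat.simps [simp del]

definition encode_int :: "int \<Rightarrow> nat list" where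
  "encode_int i = (if i < 0 then [Sym_minus] else []) @ encode_nat (nat \<bar>i\<bar>)"

definition encode_rat :: "rat \<Rightarrow> nat list" where
  "encode_rat r =
     (case quotient_of r of (p, q) \<Rightarrow> encode_int p @ [Sym_slash] @ encode_nat (nat q) @ [Sym_end])"

definition encode_dim :: "nat \<Rightarrow> nat list" where
  "encode_dim n = replicate n Sym_1 @ [Sym_end]"

definition encode_vec :: "rat vec \<Rightarrow> nat list" where
  "encode_vec v = encode_dim (dim_vec v) @ concat (map encode_rat (list_of_vec v))"

definition encode_mat :: "rat mat \<Rightarrow> nat list" where
  "encode_mat C = encode_dim (dim_row C) @ encode_dim (dim_col C) @
     concat (map encode_rat (concat (mat_to_list C)))"

definition encode_instance :: "adapt_instance \<Rightarrow> nat list" where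
  "encode_instance I =
     encode_nat (R_bound I) @ [Sym_end] @
     encode_mat (A_mat I) @ encode_vec (a_vec I) @
     encode_mat (B_mat I) @ encode_vec (b_vec I) @
     encode_mat (W_mat I) @
     encode_dim (length (T_mats I)) @ concat (map encode_mat (T_mats I))"


text \<open>Sanity check: instances are determined by their codes.\<close>

definition decode_nat :: "nat list \<Rightarrow> nat" where
  "decode_nat = foldl (\<lambda>n s. 2 * n + (if s = Sym_1 then 1 else 0)) 0"

lemma decode_encode_nat: "decode_nat (encode_nat n) = n"
proof (induction n rule: encode_nat.induct)
  case (1 n)
  then show ?case
    by (subst encode_nat.simps) (auto simp: decode_nat_def less_2_cases_iff odd_two_times_div_two_succ)
qed

lemma set_encode_nat: "set (encode_nat n) \<subseteq> {Sym_0, Sym_1}"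
proof (induction n rule: encode_nat.induct)
  case (1 n)
  then show ?case by (subst encode_nat.simps) auto
qed

lemma encode_nat_neq_Nil: "encode_nat n \<noteq> []"
  by (subst encode_nat.simps) auto

lemma append_sep_eq:
  assumes "xs @ s # r = ys @ s # r'" "s \<notin> set xs" "s \<notin> set ys"
  shows "xs = ys \<and> r = r'"
  using assms by (induction xs arbitrary: ys) (auto simp: Cons_eq_append_conv)

lemma encode_nat_sep:
  assumes "encode_nat n @ s # r = encode_nat n' @ s # r'" "2 < s"
  shows "n = n' \<and> r = r'"
proof -
  have "s \<notin> set (encode_nat n)" "s \<notin> set (encode_nat n')"
    using set_encode_nat[of n] set_encode_nat[of n'] assms(2) by auto
  from append_sep_eq[OF assms(1) this] show ?thesis by (metis decode_encode_nat)
qed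

lemma encode_int_sep:
  assumes "encode_int i @ s # r = encode_int i' @ s # r'" "3 < s"
  shows "i = i' \<and> r = r'"
proof -
  have hd: "\<exists>z zs. encode_nat n = z # zs \<and> z \<noteq> Sym_minus" for n
    using set_encode_nat[of n] encode_nat_neq_Nil[of n] by (cases "encode_nat n") auto
  have "(i < 0) = (i' < 0)"
  proof -
    obtain z zs where z: "encode_nat (nat \<bar>i\<bar>) = z # zs" "z \<noteq> Sym_minus" using hd by blast
    obtain z' zs' where z': "encode_nat (nat \<bar>i'\<bar>) = z' # zs'" "z' \<noteq> Sym_minus" using hd by blast
    from assms(1) show ?thesis
      by (cases "i < 0"; cases "i' < 0") (use z z' in \<open>simp_all add: encode_int_def\<close>)
  qed
  moreover from this have
    "encode_nat (nat \<bar>i\<bar>) @ s # r = encode_nat (nat \<bar>i'\<bar>) @ s # r'"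
    using assms(1) by (cases "i' < 0") (simp_all add: encode_int_def)
  then have "nat \<bar>i\<bar> = nat \<bar>i'\<bar> \<and> r = r'" by (rule encode_nat_sep) (use assms(2) in simp)
  ultimately show ?thesis by linarith
qed

lemma encode_rat_append:
  assumes "encode_rat x @ r = encode_rat x' @ r'"
  shows "x = x' \<and> r = r'"
proof -
  obtain p q where pq: "quotient_of x = (p, q)" by (cases "quotient_of x")
  obtain p' q' where pq': "quotient_of x' = (p', q')" by (cases "quotient_of x'")
  have "encode_int p @ Sym_slash # encode_nat (nat q) @ Sym_end # r =
        encode_int p' @ Sym_slash # encode_nat (nat q') @ Sym_end # r'"
    using assms pq pq' by (simp add: encode_rat_def)
  from encode_int_sep[OF this] have p: "p = p'"
    and "encode_nat (nat q) @ Sym_end # r = encode_nat (nat q') @ Sym_end # r'" by auto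
  from encode_nat_sep[OF this(2)] have "nat q = nat q'" "r = r'" by auto
  moreover have "q > 0" "q' > 0" using pq pq' quotient_of_denom_pos by blast+
  ultimately show ?thesis using p pq pq' quotient_of_inject[of x x'] by simp
qed

lemma encode_dim_append:
  assumes "encode_dim n @ r = encode_dim n' @ r'"
  shows "n = n' \<and> r = r'"
proof -
  have "replicate n Sym_1 = replicate n' Sym_1 \<and> r = r'"
    by (rule append_sep_eq[of _ Sym_end]) (use assms in \<open>auto simp: encode_dim_def\<close>)
  then show ?thesis by (metis length_replicate)
qed

lemma encode_list_append:
  assumes "\<And>x x' r r'. enc x @ r = enc x' @ r' \<Longrightarrow> x = x' \<and> r = r'"
    and "length xs = length xs'" and "concat (map enc xs) @ r = concat (map enc xs') @ r'"
  shows "xs = xs' \<and> r = r'"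
  using assms(2,3)
proof (induction xs xs' rule: list_induct2)
  case (Cons x xs x' xs')
  from Cons.prems have "enc x @ (concat (map enc xs) @ r) = enc x' @ (concat (map enc xs') @ r')"
    by simp
  from assms(1)[OF this] show ?case using Cons.IH by simp
qed simp

lemma encode_vec_append:
  assumes "encode_vec v @ r = encode_vec v' @ r'"
  shows "v = v' \<and> r = r'"
proof -
  note 1 = encode_dim_append[OF assms[unfolded encode_vec_def append_assoc]]
  have "list_of_vec v = list_of_vec v' \<and> r = r'"
    using 1 by (intro encode_list_append[of encode_rat] encode_rat_append) simp_all
  then show ?thesis by (metis vec_list)
qed

lemma encode_mat_append:
  assumes "encode_mat C @ r = encode_mat C' @ r'"
  shows "C = C' \<and> r = r'"
proof -
  note 1 = encode_dim_append[OF assms[unfolded encode_mat_def append_assoc]]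
  note 2 = encode_dim_append[OF 1[THEN conjunct2]]
  have d: "dim_row C = dim_row C'" "dim_col C = dim_col C'" using 1 2 by blast+
  have l: "length (concat (mat_to_list D)) = dim_row D * dim_col D" for D :: "rat mat"
    by (simp add: mat_to_list_def length_concat o_def sum_list_triv)
  have "concat (mat_to_list C) = concat (mat_to_list C') \<and> r = r'"
    using 2[THEN conjunct2]
    by (intro encode_list_append[of encode_rat] encode_rat_append) (simp_all add: l d)
  moreover from this have "mat_to_list C = mat_to_list C'"
    by (intro concat_injective) (auto simp: mat_to_list_def d set_zip)
  then have "C $$ (i, j) = C' $$ (i, j)" if "i < dim_row C" "j < dim_col C" for i j
    using that d by (auto simp: mat_to_list_def)
  ultimately show ?thesis using d eq_matI[of C' C] by simp
qed

lemma inj_encode_instance: "inj encode_instance"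
proof (rule injI)
  fix I I' :: adapt_instance
  assume "encode_instance I = encode_instance I'"
  then have *: "encode_nat (R_bound I) @ Sym_end #
     encode_mat (A_mat I) @ encode_vec (a_vec I) @ encode_mat (B_mat I) @ encode_vec (b_vec I) @
     encode_mat (W_mat I) @ encode_dim (length (T_mats I)) @ concat (map encode_mat (T_mats I)) @ []
   = encode_nat (R_bound I') @ Sym_end #
     encode_mat (A_mat I') @ encode_vec (a_vec I') @ encode_mat (B_mat I') @ encode_vec (b_vec I') @
     encode_mat (W_mat I') @ encode_dim (length (T_mats I')) @ concat (map encode_mat (T_mats I')) @ []"
    by (simp add: encode_instance_def)
  note 1 = encode_nat_sep[OF *]
  note 2 = encode_mat_append[OF 1[THEN conjunct2]]
  note 3 = encode_vec_append[OF 2[THEN conjunct2]]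
  note 4 = encode_mat_append[OF 3[THEN conjunct2]]
  note 5 = encode_vec_append[OF 4[THEN conjunct2]]
  note 6 = encode_mat_append[OF 5[THEN conjunct2]]
  note 7 = encode_dim_append[OF 6[THEN conjunct2]]
  note 8 = encode_list_append[OF encode_mat_append 7[THEN conjunct1] 7[THEN conjunct2]]
  show "I = I'" using 1 2 3 4 5 6 8 by (intro adapt_instance.equality) simp_all
qed


section \<open>The decision problem\<close>

datatype var_type = Continuous | Discrete

text \<open>The box \<open>[0,R]\<^sup>n\<close>, or its integer points.\<close>

definition box_points :: "var_type \<Rightarrow> nat \<Rightarrow> nat \<Rightarrow> real vec set" where
  "box_points c R n = {v \<in> carrier_vec n.
     \<forall>i<n. 0 \<le> v $ i \<and> v $ i \<le> real R \<and> (c = Discrete \<longrightarrow> v $ i \<in> \<int>)}"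

definition X_set :: "var_type \<Rightarrow> adapt_instance \<Rightarrow> real vec set" where
  "X_set c I = {x \<in> box_points c (R_bound I) (n_x I).
     map_mat real_of_rat (A_mat I) *\<^sub>v x \<le> map_vec real_of_rat (a_vec I)}"

definition U_set :: "var_type \<Rightarrow> adapt_instance \<Rightarrow> real vec set" where
  "U_set c I = {u \<in> box_points c (R_bound I) (n_u I).
     map_mat real_of_rat (B_mat I) *\<^sub>v u \<le> map_vec real_of_rat (b_vec I)}"

definition T_of :: "adapt_instance \<Rightarrow> real vec \<Rightarrow> real mat" where
  "T_of I u = mat (m_y I) (n_x I) (\<lambda>(i, j). \<Sum>k<n_u I. u $ k * real_of_rat (T_mats I ! k $$ (i, j)))"

definition Y_set :: "var_type \<Rightarrow> adapt_instance \<Rightarrow> real vec \<Rightarrow> real vec \<Rightarrow> real vec set" where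
  "Y_set c I x u = {y \<in> box_points c (R_bound I) (n_y I).
     T_of I u *\<^sub>v x + map_mat real_of_rat (W_mat I) *\<^sub>v y \<le> 0\<^sub>v (m_y I)}"

definition K_adaptable ::
    "var_type \<Rightarrow> var_type \<Rightarrow> var_type \<Rightarrow> nat \<Rightarrow> adapt_instance \<Rightarrow> bool" where
  "K_adaptable cX cU cY K I \<longleftrightarrow>
     (\<exists>x \<in> X_set cX I. \<exists>y :: nat \<Rightarrow> real vec. (\<forall>k \<in> {1..K}. y k \<in> carrier_vec (n_y I)) \<and>
        (\<forall>u \<in> U_set cU I. y ` {1..K} \<inter> Y_set cY I x u \<noteq> {}))"

definition bounded_adaptability ::
    "(adapt_instance \<Rightarrow> nat) \<Rightarrow> var_type \<Rightarrow> var_type \<Rightarrow> var_type \<Rightarrow> adapt_instance decision_problem" where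
  "bounded_adaptability K cX cU cY =
     \<lparr>instances = {I. wf_instance I},
      yes_instances = {I. wf_instance I \<and> K_adaptable cX cU cY (K I) I},
      encoding = encode_instance\<rparr>"

definition polynomial_in_input :: "(adapt_instance \<Rightarrow> nat) \<Rightarrow> bool" where
  "polynomial_in_input K \<longleftrightarrow>
     (\<exists>p :: nat poly. \<forall>I. wf_instance I \<longrightarrow> K I \<le> poly p (length (encode_instance I)))"

end

theory Submission
  imports Defs
begin

text \<open>The reduction does not depend on \<open>K\<close>. Give every row \<open>i\<close> of the system \<open>T(u) x + W y \<le> 0\<close> its own
  independent copy \<open>u\<^sup>i \<in> U\<close> of the uncertain vector, so that the \<open>i\<close>-th constraint reads
  \<open>T\<^sub>i(u\<^sup>i) x + W\<^sub>i y \<le> 0\<close>. A policy that is feasible for all \<open>u \<in> U\<close> stays feasible. Conversely, if each of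
  finitely many policies is violated by some scenario in \<open>U\<close>, then choosing as \<open>u\<^sup>i\<close> the one among these scenarios
  that maximizes \<open>T\<^sub>i(u) x\<close> violates all policies at once; so the new instance is \<open>K\<close>-adaptable, for any \<open>K \<ge> 1\<close>, iff
  the old one is 1-adaptable.

  The new \<open>B\<close> is block diagonal with \<open>m\<^sub>y\<close> copies of the old one, and each coefficient matrix of \<open>T\<close> is split into
  its rows. As all dimensions are coded in unary, a Turing machine can compute the new code by nested loops over
  unary counters on work tapes.\<close>

section \<open>Structured Turing machine programs\<close>

text \<open>Row i reads T_i(u) x + W_i y \<le> 0, and its uncertain term does not involve y. For a
  fixed x the scenarios can therefore be ranked row by row, in the same order for all policies; K
  policies can beat one only because a single u must serve all rows at once. Decoupling the rows
  ends this with a maximum over finitely many scenarios, so no compactness enters and continuous and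
  discrete sets are treated alike. K is evaluated at the produced instance: a construction that grew
  with K would have to cope with K growing in turn.

  Most of the work is the machine, since a reduction asks for one concrete machine that writes the
  new code exactly. No arithmetic on rationals occurs: every entry of the new B and T is an old
  entry or 0, so numbers are moved as opaque words ending in \<open>Sym_end\<close>. Machines are
  built from sequence, test and loop, and each rule about runs gives the final tapes together with a
  time bound. The 15 tapes are input, output, one for R, six for dimensions and six for lists of
  entries.\<close>

definition tape_num :: nat where "tape_num = 15"

abbreviation sym_num :: nat where "sym_num \<equiv> 6"

type_synonym ztape = "nat list \<times> nat list"
type_synonym store = "nat \<Rightarrow> ztape"

text \<open>A pair \<open>(l, r)\<close> stands for a tape whose head is at position \<open>length l\<close>, with \<open>rev l\<close> to the left
  of the head and \<open>r\<close> from the head on.\<close>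

definition scan :: "ztape \<Rightarrow> nat" where
  "scan z = (case snd z of [] \<Rightarrow> 0 | x # _ \<Rightarrow> x)"

text \<open>Trailing blanks may be written out or not, so different pairs can denote the same tape.
  Everything left of position 0 is blank; the rule for left moves accordingly asks for a nonempty
  left part.\<close>

definition tape_of :: "ztape \<Rightarrow> tape" where
  "tape_of z = (word_contents (rev (fst z) @ snd z), int (length (fst z)))"

definition tapes_of :: "store \<Rightarrow> tape list" where
  "tapes_of s = map (\<lambda>i. tape_of (s i)) [0..<tape_num]"

definition scans :: "store \<Rightarrow> nat list" where
  "scans s = map (\<lambda>i. scan (s i)) [0..<tape_num]"

lemma scan_simps [simp]: "scan (l, []) = 0" "scan (l, x # r) = x"
  by (simp_all add: scan_def)

lemma scans_nth [simp]: "i < tape_num \<Longrightarrow> scans s ! i = scan (s i)"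
  by (simp add: scans_def)

lemma length_scans [simp]: "length (scans s) = tape_num"
  by (simp add: scans_def)

lemma word_contents_scan:
  "word_contents (rev l @ r) (int (length l)) = scan (l, r)"
  by (cases r) (auto simp: word_contents_def nth_append)

lemma scanned_symbols: "map (\<lambda>(t, h). t h) (tapes_of s) = scans s"
  by (auto simp: tapes_of_def scans_def tape_of_def word_contents_scan)

text \<open>The bound on the next state is demanded for every list of symbols, even an ill-formed
  one. Thus \<open>embed_steps\<close> can follow a run on arbitrary tapes without an invariant on
  the scanned symbols.\<close>

definition ok_transition :: "nat \<Rightarrow> nat list \<Rightarrow> nat \<times> (nat \<times> head_move) list \<Rightarrow> bool" where
  "ok_transition n ss x \<longleftrightarrow> fst x \<le> n \<and>
     (length ss = tape_num \<and> set ss \<subseteq> {..<sym_num} \<longrightarrow>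
        length (snd x) = tape_num \<and> fst ` set (snd x) \<subseteq> {..<sym_num})"

definition is_program :: "turing_machine \<Rightarrow> bool" where
  "is_program M \<longleftrightarrow> tapes M = tape_num \<and> symbols M = sym_num \<and>
     (\<forall>q<states M. \<forall>ss. ok_transition (states M) ss (transition M q ss))"

lemma wf_tm_program:
  assumes "is_program M"
  shows "wf_tm M"
proof -
  have "q' \<le> states M \<and> length acts = tapes M \<and> fst ` set acts \<subseteq> {..<symbols M}"
    if "q < states M" "length ss = tapes M" "set ss \<subseteq> {..<symbols M}" "transition M q ss = (q', acts)"
    for q ss q' acts
  proof -
    have "ok_transition (states M) ss (transition M q ss)"
      using assms that(1) by (simp add: is_program_def)
    then show ?thesis using that assms by (simp add: ok_transition_def is_program_def)
  qed
  moreover have "2 \<le> tapes M" "0 < symbols M" using assms by (simp_all add: is_program_def tape_num_def)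
  ultimately show ?thesis unfolding wf_tm_def by blast
qed

definition runs :: "turing_machine \<Rightarrow> store \<Rightarrow> nat \<Rightarrow> store \<Rightarrow> bool" where
  "runs M s t s' \<longleftrightarrow> (tm_step M ^^ t) (0, tapes_of s) = (states M, tapes_of s')"

lemma halted: "(tm_step M ^^ t) (states M, ts) = (states M, ts)"
  by (induction t) auto

lemma steps_mono:
  assumes "(tm_step M ^^ t) c = (states M, ts)" "t \<le> t'"
  shows "(tm_step M ^^ t') c = (states M, ts)"
proof -
  have "t' = (t' - t) + t" using assms(2) by simp
  then show ?thesis using assms(1) halted by (metis funpow_add o_apply)
qed

lemma runs_mono: "runs M s t s' \<Longrightarrow> t \<le> t' \<Longrightarrow> runs M s t' s'"
  unfolding runs_def by (rule steps_mono)

definition keep :: "nat list \<Rightarrow> (nat \<times> head_move) list" where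
  "keep ss = map (\<lambda>x. (x, Move_None)) ss"

lemma length_keep [simp]: "length (keep ss) = length ss"
  by (simp add: keep_def)

lemma act_keep [simp]: "map2 act_on_tape (keep (scans s)) (tapes_of s) = tapes_of s"
  by (rule nth_equalityI)
     (auto simp: keep_def tapes_of_def tape_of_def scans_def word_contents_scan fun_upd_idem)

text \<open>A frame rule: \<open>keep\<close> writes each scanned symbol back in place, so an action
  list that differs from it only at \<open>j\<close> touches no other tape. All elementary programs
  have this form.\<close>

lemma act_update:
  assumes "j < tape_num" "act_on_tape (a, d) (tape_of (s j)) = tape_of z"
  shows "map2 act_on_tape ((keep (scans s))[j := (a, d)]) (tapes_of s) = tapes_of (s(j := z))"
proof (rule nth_equalityI)
  fix i assume "i < length (map2 act_on_tape ((keep (scans s))[j := (a, d)]) (tapes_of s))"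
  then show "map2 act_on_tape ((keep (scans s))[j := (a, d)]) (tapes_of s) ! i = tapes_of (s(j := z)) ! i"
    using assms
    by (cases "i = j")
       (auto simp: keep_def tapes_of_def tape_of_def scans_def word_contents_scan fun_upd_idem)
qed (simp add: tapes_of_def)


subsection \<open>Combinators\<close>

text \<open>In \<open>embed M k e\<close> the states of \<open>M\<close> start at \<open>k\<close> and its halting state is identified with \<open>e\<close>.\<close>

definition entry :: "turing_machine \<Rightarrow> nat \<Rightarrow> nat \<Rightarrow> nat \<Rightarrow> nat" where
  "entry M k e q = (if q = states M then e else k + q)"

definition embed :: "turing_machine \<Rightarrow> nat \<Rightarrow> nat \<Rightarrow> nat \<Rightarrow> nat list \<Rightarrow> nat \<times> (nat \<times> head_move) list" where
  "embed M k e q ss =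
     (let (q', acts) = transition M (q - k) ss in (entry M k e q', acts))"

text \<open>Until \<open>M\<close> halts, \<open>N\<close> imitates it step by step. The count
  \<open>t'\<close> may be smaller than \<open>t\<close>: a halted \<open>M\<close> idles up to time
  \<open>t\<close>, whereas \<open>e\<close> may be a working state of \<open>N\<close>, which must
  be caught at the moment it is reached.\<close>

lemma embed_steps:
  assumes "is_program M"
    and N: "\<And>q ss. q < states M \<Longrightarrow> transition N (k + q) ss = embed M k e (k + q) ss"
    and lt: "k + states M \<le> states N"
    and q: "q \<le> states M" and run: "(tm_step M ^^ t) (q, ts) = (states M, ts')"
  shows "\<exists>t'\<le>t. (tm_step N ^^ t') (entry M k e q, ts) = (e, ts')"
  using q run
proof (induction t arbitrary: q ts)
  case 0
  then show ?case by (auto simp: entry_def)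
next
  case (Suc t)
  show ?case
  proof (cases "q = states M")
    case True
    with Suc.prems show ?thesis by (intro exI[of _ 0]) (simp add: entry_def halted del: funpow.simps(2))
  next
    case False
    with Suc.prems have q: "q < states M" by simp
    obtain q' acts where tr: "transition M q (map (\<lambda>(t, h). t h) ts) = (q', acts)"
      by (cases "transition M q (map (\<lambda>(t, h). t h) ts)")
    have "q' \<le> states M" using assms(1) q tr unfolding is_program_def ok_transition_def by (metis fst_conv)
    moreover have "tm_step M (q, ts) = (q', map2 act_on_tape acts ts)" using q tr by simp
    ultimately obtain t' where t': "t' \<le> t"
        "(tm_step N ^^ t') (entry M k e q', map2 act_on_tape acts ts) = (e, ts')"
      using Suc.IH[of q' "map2 act_on_tape acts ts"] Suc.prems(2) by (auto simp: funpow_swap1)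
    have "tm_step N (entry M k e q, ts) = (entry M k e q', map2 act_on_tape acts ts)"
      using q lt N[OF q] tr by (simp add: embed_def entry_def)
    then have "(tm_step N ^^ Suc t') (entry M k e q, ts) = (e, ts')"
      using t'(2) by (simp add: funpow_swap1)
    with t'(1) show ?thesis by (intro exI[of _ "Suc t'"]) simp
  qed
qed

lemma embed_runs:
  assumes "is_program M"
    and "\<And>q ss. q < states M \<Longrightarrow> transition N (k + q) ss = embed M k e (k + q) ss"
    and "k + states M \<le> states N"
    and "runs M s t s'"
  shows "\<exists>t'\<le>t. (tm_step N ^^ t') (entry M k e 0, tapes_of s) = (e, tapes_of s')"
  using embed_steps[OF assms(1-3), of 0 t "tapes_of s" "tapes_of s'"] assms(4) by (simp add: runs_def)

lemma ok_embed:
  assumes "is_program M" "k \<le> q" "q < k + states M" "e \<le> n" "k + states M \<le> n"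
  shows "ok_transition n ss (embed M k e q ss)"
proof -
  have "ok_transition (states M) ss (transition M (q - k) ss)"
    using assms(1-3) unfolding is_program_def by (metis less_diff_conv2 add.commute)
  then show ?thesis
    using assms(4,5) unfolding ok_transition_def embed_def
    by (cases "transition M (q - k) ss") (simp add: entry_def)
qed

definition program :: "nat \<Rightarrow> (nat \<Rightarrow> nat list \<Rightarrow> nat \<times> (nat \<times> head_move) list) \<Rightarrow> turing_machine" where
  "program n \<delta> = \<lparr>tapes = tape_num, symbols = sym_num, states = n, transition = \<delta>\<rparr>"

lemma program_simps [simp]:
  "states (program n \<delta>) = n" "transition (program n \<delta>) = \<delta>"
  "tapes (program n \<delta>) = tape_num" "symbols (program n \<delta>) = sym_num"
  by (simp_all add: program_def)

definition move_tm :: "nat \<Rightarrow> head_move \<Rightarrow> turing_machine" where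
  "move_tm j d = program 1 (\<lambda>_ ss. (1, (keep ss)[j := (ss ! j, d)]))"

definition put_tm :: "nat \<Rightarrow> nat \<Rightarrow> turing_machine" where
  "put_tm j a = program 1 (\<lambda>_ ss. (1, (keep ss)[j := (a, Move_Right)]))"

definition copy_tm :: "nat \<Rightarrow> nat \<Rightarrow> turing_machine" where
  "copy_tm i j = program 1 (\<lambda>_ ss. (1, (keep ss)[j := (ss ! i, Move_Right)]))"

definition seq_tm :: "turing_machine \<Rightarrow> turing_machine \<Rightarrow> turing_machine" (infixr \<open>;;\<close> 65) where
  "M ;; N = program (states M + states N)
     (\<lambda>q. if q < states M then embed M 0 (states M) q
          else embed N (states M) (states M + states N) q)"

definition if_tm :: "nat \<Rightarrow> nat \<Rightarrow> turing_machine \<Rightarrow> turing_machine \<Rightarrow> turing_machine" where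
  "if_tm i a M N = (let e = 1 + states M + states N in program e
     (\<lambda>q ss. if q = 0 then (if ss ! i = a then entry M 1 e 0 else entry N (1 + states M) e 0, keep ss)
        else if q < 1 + states M then embed M 1 e q ss
        else embed N (1 + states M) e q ss))"

text \<open>State 0 performs the test, and the halting state of the body is identified with it,
  which closes the loop.\<close>

definition while_tm :: "nat \<Rightarrow> (nat \<Rightarrow> bool) \<Rightarrow> turing_machine \<Rightarrow> turing_machine" where
  "while_tm i p M = program (1 + states M)
     (\<lambda>q ss. if q = 0 then (if p (ss ! i) then entry M 1 0 0 else 1 + states M, keep ss)
        else embed M 1 0 q ss)"

lemma is_program_programI:
  "(\<And>q ss. q < n \<Longrightarrow> ok_transition n ss (\<delta> q ss)) \<Longrightarrow> is_program (program n \<delta>)"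
  by (simp add: is_program_def)

lemma ok_keep: "q' \<le> n \<Longrightarrow> ok_transition n ss (q', keep ss)"
  by (auto simp: ok_transition_def keep_def)

lemma ok_update:
  assumes "q' \<le> n" "length ss = tape_num \<Longrightarrow> set ss \<subseteq> {..<sym_num} \<Longrightarrow> a < sym_num"
  shows "ok_transition n ss (q', (keep ss)[j := (a, d)])"
proof -
  have "fst ` set ((keep ss)[j := (a, d)]) \<subseteq> {..<sym_num}"
    if ss: "length ss = tape_num" "set ss \<subseteq> {..<sym_num}"
  proof -
    have "fst ` set ((keep ss)[j := (a, d)]) \<subseteq> fst ` insert (a, d) (set (keep ss))"
      by (intro image_mono set_update_subset_insert)
    also have "\<dots> = insert a (set ss)" by (simp add: keep_def image_image)
    also have "\<dots> \<subseteq> {..<sym_num}" using assms(2)[OF ss] ss(2) by simp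
    finally show ?thesis .
  qed
  then show ?thesis using assms(1) by (simp add: ok_transition_def)
qed

lemma nth_symbol: "i < length ss \<Longrightarrow> set ss \<subseteq> {..<sym_num} \<Longrightarrow> ss ! i < sym_num"
  by (meson lessThan_iff nth_mem subsetD)

lemma is_program_move: "j < tape_num \<Longrightarrow> is_program (move_tm j d)"
  unfolding move_tm_def by (intro is_program_programI ok_update) (simp_all add: nth_symbol)

lemma is_program_put: "a < sym_num \<Longrightarrow> is_program (put_tm j a)"
  unfolding put_tm_def by (intro is_program_programI ok_update) simp_all

lemma is_program_copy: "i < tape_num \<Longrightarrow> is_program (copy_tm i j)"
  unfolding copy_tm_def by (intro is_program_programI ok_update) (simp_all add: nth_symbol)

lemma is_program_seq: "is_program M \<Longrightarrow> is_program N \<Longrightarrow> is_program (M ;; N)"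
  unfolding seq_tm_def by (rule is_program_programI) (auto intro!: ok_embed)

lemma is_program_if: "is_program M \<Longrightarrow> is_program N \<Longrightarrow> is_program (if_tm i a M N)"
  unfolding if_tm_def Let_def
  by (rule is_program_programI) (auto intro!: ok_embed ok_keep simp: entry_def)

lemma is_program_while: "is_program M \<Longrightarrow> is_program (while_tm i p M)"
  unfolding while_tm_def
  by (rule is_program_programI) (auto intro!: ok_embed ok_keep simp: entry_def)

lemmas is_program_intros =
  is_program_move is_program_put is_program_copy is_program_seq is_program_if is_program_while

section \<open>Effect and running time of the elementary programs and of the control
  structures\<close>

fun right :: "ztape \<Rightarrow> ztape" where
  "right (l, []) = (0 # l, [])"
| "right (l, x # r) = (x # l, r)"

lemma word_contents_int: "word_contents w (int n) = (if n < length w then w ! n else 0)"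
  by (simp add: word_contents_def)

lemma fun_int_eqI:
  assumes "\<And>n. f (int n) = g (int n)" "\<And>i. i < 0 \<Longrightarrow> f i = g i"
  shows "f = g"
proof
  show "f i = g i" for i using assms by (cases i rule: int_cases2) (metis nat_0_le not_le)+
qed

lemma word_contents_append_0: "word_contents (w @ [0]) = word_contents w"
  by (rule fun_int_eqI) (simp add: word_contents_int nth_append, simp add: word_contents_def)

lemma word_contents_upd:
  "(word_contents (w @ r))(int (length w) := a) = word_contents (w @ a # tl r)"
proof (rule fun_int_eqI)
  fix n
  show "((word_contents (w @ r))(int (length w) := a)) (int n) = word_contents (w @ a # tl r) (int n)"
    by (cases n "length w" rule: linorder_cases; cases r)
       (auto simp: word_contents_int nth_append nth_Cons')
qed (simp add: word_contents_def)

text \<open>Beyond the stored word \<open>right\<close> makes one blank explicit, which leaves the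
  tape unchanged. Starting from an empty tape this yields \<open>([0], [])\<close>, the origin of
  the end marker at position 0 of the work tapes.\<close>

lemma tape_right: "act_on_tape (scan z, Move_Right) (tape_of z) = tape_of (right z)"
proof (cases z)
  case (Pair l r)
  then show ?thesis using word_contents_upd[of "rev l" r "scan (l, r)"]
    by (cases r) (simp_all add: tape_of_def word_contents_append_0)
qed

lemma tape_put: "act_on_tape (a, Move_Right) (tape_of (l, r)) = tape_of (a # l, tl r)"
  using word_contents_upd[of "rev l" r a] by (simp add: tape_of_def)

lemma tape_left: "act_on_tape (scan (x # l, r), Move_Left) (tape_of (x # l, r)) = tape_of (l, x # r)"
  using word_contents_upd[of "rev (x # l)" r "scan (x # l, r)"]
    word_contents_append_0[of "rev l @ [x]"]
  by (cases r) (simp_all add: tape_of_def)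

lemma runs_single:
  assumes "j < tape_num" "act_on_tape (a, d) (tape_of (s j)) = tape_of z"
    and "\<delta> 0 (scans s) = (1, (keep (scans s))[j := (a, d)])"
  shows "runs (program 1 \<delta>) s 1 (s(j := z))"
  using act_update[of j a d s z] assms by (simp add: runs_def scanned_symbols del: act_on_tape.simps)

lemma runs_right: "j < tape_num \<Longrightarrow> runs (move_tm j Move_Right) s 1 (s(j := right (s j)))"
  unfolding move_tm_def by (rule runs_single) (simp_all add: tape_right)

lemma runs_left: "j < tape_num \<Longrightarrow> s j = (x # l, r) \<Longrightarrow>
    runs (move_tm j Move_Left) s 1 (s(j := (l, x # r)))"
  unfolding move_tm_def by (rule runs_single) (simp_all add: tape_left del: act_on_tape.simps)

lemma runs_put: "j < tape_num \<Longrightarrow> s j = (l, r) \<Longrightarrow>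
    runs (put_tm j a) s 1 (s(j := (a # l, tl r)))"
  unfolding put_tm_def by (rule runs_single) (simp_all add: tape_put del: act_on_tape.simps)

lemma runs_copy: "i < tape_num \<Longrightarrow> j < tape_num \<Longrightarrow> s j = (l, r) \<Longrightarrow>
    runs (copy_tm i j) s 1 (s(j := (scan (s i) # l, tl r)))"
  unfolding copy_tm_def by (rule runs_single) (simp_all add: tape_put del: act_on_tape.simps)

lemma runsI:
  assumes "(tm_step M ^^ t') (0, tapes_of s) = (states M, tapes_of s')" "t' \<le> t"
  shows "runs M s t s'"
  using steps_mono[OF assms] by (simp add: runs_def)

lemma runs_seq:
  assumes M: "is_program M" "runs M s t s'" and N: "is_program N" "runs N s' t' s''"
  shows "runs (M ;; N) s (t + t') s''"
proof -
  obtain t1 where t1: "t1 \<le> t" "(tm_step (M ;; N) ^^ t1) (entry M 0 (states M) 0, tapes_of s) = (states M, tapes_of s')"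
    using embed_runs[OF M(1) _ _ M(2), of "M ;; N" 0 "states M"] by (auto simp: seq_tm_def)
  obtain t2 where t2: "t2 \<le> t'" "(tm_step (M ;; N) ^^ t2)
      (entry N (states M) (states M + states N) 0, tapes_of s') = (states M + states N, tapes_of s'')"
    using embed_runs[OF N(1) _ _ N(2), of "M ;; N" "states M" "states M + states N"] by (auto simp: seq_tm_def)
  have "entry M 0 (states M) 0 = 0" "entry N (states M) (states M + states N) 0 = states M"
    by (auto simp: entry_def)
  then have "(tm_step (M ;; N) ^^ (t2 + t1)) (0, tapes_of s) = (states (M ;; N), tapes_of s'')"
    using t1(2) t2(2) by (simp add: funpow_add) (simp add: seq_tm_def)
  then show ?thesis by (rule runsI) (use t1 t2 in simp)
qed

lemma runs_if:
  assumes "is_program M" "is_program N" "i < tape_num"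
    and "scan (s i) = a \<Longrightarrow> runs M s t s'" and "scan (s i) \<noteq> a \<Longrightarrow> runs N s t s'"
  shows "runs (if_tm i a M N) s (Suc t) s'"
proof -
  let ?P = "if_tm i a M N" and ?n = "1 + states M + states N"
  let ?q = "if scan (s i) = a then entry M 1 ?n 0 else entry N (1 + states M) ?n 0"
  have "\<exists>t'\<le>t. (tm_step ?P ^^ t') (?q, tapes_of s) = (?n, tapes_of s')"
  proof (cases "scan (s i) = a")
    case True
    then show ?thesis using embed_runs[OF assms(1) _ _ assms(4)[OF True], of ?P 1 ?n]
      by (simp add: if_tm_def Let_def)
  next
    case False
    then show ?thesis using embed_runs[OF assms(2) _ _ assms(5)[OF False], of ?P "1 + states M" ?n]
      by (simp add: if_tm_def Let_def)
  qed
  moreover have "tm_step ?P (0, tapes_of s) = (?q, tapes_of s)"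
    using assms(3) by (simp add: if_tm_def Let_def scanned_symbols)
  ultimately obtain t' where "t' \<le> t" "(tm_step ?P ^^ Suc t') (0, tapes_of s) = (?n, tapes_of s')"
    by (auto simp: funpow_swap1)
  then show ?thesis by (intro runsI[where t' = "Suc t'"]) (simp_all add: if_tm_def Let_def)
qed

text \<open>The loop invariant is the explicit family \<open>S\<close> of stores before each round.
  A round costs one step for the test besides the body, and the failing test costs the final step;
  the induction peels off the first round by shifting \<open>S\<close>.\<close>

lemma runs_while:
  assumes M: "is_program M" "i < tape_num"
    and "\<And>k. k < n \<Longrightarrow> p (scan (S k i))" "\<And>k. k < n \<Longrightarrow> runs M (S k) t (S (Suc k))"
    and "\<not> p (scan (S n i))"
  shows "runs (while_tm i p M) (S 0) (n * Suc t + 1) (S n)"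
  using assms(3-)
proof (induction n arbitrary: S)
  case 0
  then show ?case using M(2) by (simp add: runs_def while_tm_def scanned_symbols)
next
  case (Suc n)
  let ?P = "while_tm i p M"
  have r: "runs M (S 0) t (S 1)" using Suc.prems(2)[of 0] by simp
  obtain t' where t': "t' \<le> t" "(tm_step ?P ^^ t') (entry M 1 0 0, tapes_of (S 0)) = (0, tapes_of (S 1))"
    using embed_runs[OF M(1) _ _ r, of ?P 1 0] by (auto simp: while_tm_def)
  have "tm_step ?P (0, tapes_of (S 0)) = (entry M 1 0 0, tapes_of (S 0))"
    using M(2) Suc.prems(1)[of 0] by (simp add: while_tm_def scanned_symbols)
  then have 1: "(tm_step ?P ^^ Suc t') (0, tapes_of (S 0)) = (0, tapes_of (S 1))"
    using t'(2) by (simp add: funpow_swap1)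
  have "runs ?P (S (Suc 0)) (n * Suc t + 1) (S (Suc n))"
    using Suc.IH[of "\<lambda>k. S (Suc k)"] Suc.prems by simp
  then have "(tm_step ?P ^^ ((n * Suc t + 1) + Suc t')) (0, tapes_of (S 0)) = (states ?P, tapes_of (S (Suc n)))"
    using 1 unfolding runs_def funpow_add by (simp del: funpow.simps)
  then show ?case by (rule runsI) (use t' in simp)
qed

lemma runs_cong:
  "runs M s t s' \<Longrightarrow> s = s1 \<Longrightarrow> s' = s2 \<Longrightarrow> t \<le> t' \<Longrightarrow> runs M s1 t' s2"
  using runs_mono by blast

declare is_program_intros [simp]

lemma runs_rightI:
  "j < tape_num \<Longrightarrow> s' = s(j := right (s j)) \<Longrightarrow> runs (move_tm j Move_Right) s 1 s'"
  using runs_right by blast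

lemma runs_leftI:
  "j < tape_num \<Longrightarrow> s j = (x # l, r) \<Longrightarrow> s' = s(j := (l, x # r)) \<Longrightarrow> runs (move_tm j Move_Left) s 1 s'"
  using runs_left by blast

lemma runs_putI:
  "j < tape_num \<Longrightarrow> s j = (l, r) \<Longrightarrow> s' = s(j := (a # l, tl r)) \<Longrightarrow> runs (put_tm j a) s 1 s'"
  using runs_put by blast

lemma runs_copyI:
  "i < tape_num \<Longrightarrow> j < tape_num \<Longrightarrow> s j = (l, r) \<Longrightarrow> s' = s(j := (scan (s i) # l, tl r)) \<Longrightarrow>
    runs (copy_tm i j) s 1 s'"
  using runs_copy by blast

section \<open>Programs for words and counters on work tapes\<close>

abbreviation right_tm :: "nat \<Rightarrow> turing_machine" where
  "right_tm j \<equiv> move_tm j Move_Right"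

abbreviation left_tm :: "nat \<Rightarrow> turing_machine" where
  "left_tm j \<equiv> move_tm j Move_Left"

text \<open>Work tapes hold a word of nonblank symbols that starts at position 1; the blank at position 0 marks the
  left end.\<close>

definition rewind_tm :: "nat \<Rightarrow> turing_machine" where
  "rewind_tm j = left_tm j ;; while_tm j (\<lambda>a. a \<noteq> 0) (left_tm j) ;; right_tm j"

definition for_tm :: "nat \<Rightarrow> turing_machine \<Rightarrow> turing_machine" where
  "for_tm c M = while_tm c (\<lambda>a. a \<noteq> 0) (M ;; right_tm c) ;; rewind_tm c"

definition copy_token_tm :: "nat \<Rightarrow> nat \<Rightarrow> turing_machine" where
  "copy_token_tm i j = while_tm i (\<lambda>a. a \<noteq> Sym_end) (copy_tm i j ;; right_tm i) ;; copy_tm i j ;; right_tm i"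

text \<open>The separator is read but not copied, so that a dimension coded in unary becomes a bare
  word over which \<open>for_tm\<close> can iterate.\<close>

definition copy_word_tm :: "nat \<Rightarrow> nat \<Rightarrow> turing_machine" where
  "copy_word_tm i j = while_tm i (\<lambda>a. a \<noteq> Sym_end) (copy_tm i j ;; right_tm i) ;; right_tm i"

definition skip_token_tm :: "nat \<Rightarrow> turing_machine" where
  "skip_token_tm i = while_tm i (\<lambda>a. a \<noteq> Sym_end) (right_tm i) ;; right_tm i"

text \<open>In round \<open>k\<close>, the body finds the \<open>k\<close>-th symbol on tape \<open>c\<close> replaced by \<open>Sym_0\<close>, so that a loop over \<open>c\<close> inside
  the body can test whether its index is \<open>k\<close>.\<close>

definition mark_each_tm :: "nat \<Rightarrow> turing_machine \<Rightarrow> turing_machine" where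
  "mark_each_tm c M = while_tm c (\<lambda>a. a \<noteq> 0)
     (put_tm c Sym_0 ;; rewind_tm c ;; M ;; while_tm c (\<lambda>a. a = Sym_1) (right_tm c) ;; put_tm c Sym_1) ;;
     rewind_tm c"

text \<open>The initial move to the right leaves the blank at position 0 at which the closing
  \<open>rewind_tm\<close> stops.\<close>

definition load_tm :: "nat \<Rightarrow> turing_machine \<Rightarrow> turing_machine" where
  "load_tm j M = right_tm j ;; M ;; rewind_tm j"

definition from_tm :: "nat \<Rightarrow> turing_machine \<Rightarrow> turing_machine" where
  "from_tm e M = M ;; rewind_tm e"

lemma is_program_rewind [simp]: "j < tape_num \<Longrightarrow> is_program (rewind_tm j)"
  by (simp add: rewind_tm_def)

lemma is_program_derived [simp]:
  "is_program M \<Longrightarrow> j < tape_num \<Longrightarrow> is_program (for_tm j M)"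
  "i < tape_num \<Longrightarrow> is_program (copy_token_tm i j)"
  "i < tape_num \<Longrightarrow> is_program (copy_word_tm i j)"
  "i < tape_num \<Longrightarrow> is_program (skip_token_tm i)"
  "is_program M \<Longrightarrow> j < tape_num \<Longrightarrow> is_program (mark_each_tm j M)"
  "is_program M \<Longrightarrow> j < tape_num \<Longrightarrow> is_program (load_tm j M)"
  "is_program M \<Longrightarrow> j < tape_num \<Longrightarrow> is_program (from_tm j M)"
  by (simp_all add: for_tm_def copy_token_tm_def copy_word_tm_def skip_token_tm_def mark_each_tm_def
      load_tm_def from_tm_def)

text \<open>As \<open>w\<close> contains no blank, the first blank met on the way left is the end
  marker. The time consists of one move left, two steps for each symbol of \<open>w\<close>, the
  failing test and the move off the marker.\<close>

lemma runs_rewind: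
  assumes j: "j < tape_num" "s j = (rev w @ [0], r)" and w: "0 \<notin> set w"
  shows "runs (rewind_tm j) s (2 * length w + 3) (s(j := ([0], w @ r)))"
proof -
  \<comment> \<open>\<open>L\<close> lists the symbols left of the head, the nearest one first;
    after \<open>Suc k\<close> moves to the left the head scans \<open>L ! k\<close>.\<close>
  define L where "L = rev w @ [0]"
  define S where "S k = s(j := (drop (Suc k) L, rev (take (Suc k) L) @ r))" for k
  have len: "length L = Suc (length w)" and L_nonempty: "L \<noteq> []" by (simp_all add: L_def)
  have scan: "scan (S k j) = L ! k" if "k \<le> length w" for k
    using that len by (simp add: S_def take_Suc_conv_app_nth)
  have "runs (left_tm j) s 1 (S 0)"
    by (rule runs_leftI[where x = "hd L" and l = "tl L"])
       (use j L_nonempty in \<open>simp_all add: S_def take_Suc drop_Suc flip: L_def\<close>)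
  moreover have "runs (while_tm j (\<lambda>a. a \<noteq> 0) (left_tm j)) (S 0) (length w * Suc 1 + 1) (S (length w))"
  proof (rule runs_while)
    show "scan (S k j) \<noteq> 0" if "k < length w" for k
    proof -
      have "rev w ! k \<in> set w" using that nth_mem[of k "rev w"] by simp
      then have "rev w ! k \<noteq> 0" using w by metis
      then show ?thesis using that scan[of k] by (simp add: L_def nth_append)
    qed
    show "runs (left_tm j) (S k) 1 (S (Suc k))" if "k < length w" for k
    proof (rule runs_leftI)
      show "S k j = (L ! Suc k # drop (Suc (Suc k)) L, rev (take (Suc k) L) @ r)"
        using that len by (simp add: S_def Cons_nth_drop_Suc)
    qed (use that len j in \<open>simp_all add: S_def take_Suc_conv_app_nth\<close>)
    show "\<not> scan (S (length w) j) \<noteq> 0" using scan by (simp add: L_def nth_append)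
  qed (use j in simp_all)
  moreover have "runs (right_tm j) (S (length w)) 1 (s(j := ([0], w @ r)))"
    by (rule runs_rightI) (simp_all add: j S_def L_def)
  ultimately have "runs (rewind_tm j) s (1 + ((length w * Suc 1 + 1) + 1)) (s(j := ([0], w @ r)))"
    unfolding rewind_tm_def using j by (intro runs_seq) simp_all
  then show ?thesis by (rule runs_mono) simp
qed

lemma runs_rewindI:
  assumes "j < tape_num" "s j = (rev w @ [0], r)" "0 \<notin> set w" "s' = s(j := ([0], w @ r))" "2 * length w + 3 \<le> t"
  shows "runs (rewind_tm j) s t s'"
  using runs_rewind[of j s w r] runs_mono assms by blast

definition at_pos :: "nat list \<Rightarrow> nat \<Rightarrow> ztape" where
  "at_pos w k = (rev (take k w) @ [0], drop k w)"

lemma scan_at_pos: "k < length w \<Longrightarrow> scan (at_pos w k) = w ! k"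
  by (simp add: at_pos_def flip: Cons_nth_drop_Suc)

lemma right_at_pos: "k < length w \<Longrightarrow> right (at_pos w k) = at_pos w (Suc k)"
  by (simp add: at_pos_def take_Suc_conv_app_nth flip: Cons_nth_drop_Suc)

text \<open>The body may look at tape \<open>c\<close>, whose head stands on symbol
  \<open>k\<close>, but must leave it there; advancing is left to the loop. Of the 4 extra steps per
  symbol, one is the test, one the move right and two are spent on rewinding; the additive 4 is the
  failing test and the constant part of the rewind.\<close>

lemma runs_for:
  assumes M: "is_program M" "c < tape_num" and w: "0 \<notin> set w"
    and S: "\<And>k. k \<le> length w \<Longrightarrow> S k c = at_pos w k"
    and run: "\<And>k. k < length w \<Longrightarrow> runs M (S k) t ((S (Suc k))(c := at_pos w k))"
  shows "runs (for_tm c M) (S 0) (length w * (t + 4) + 4) ((S (length w))(c := ([0], w)))"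
proof -
  let ?n = "length w"
  have "runs (while_tm c (\<lambda>a. a \<noteq> 0) (M ;; right_tm c)) (S 0) (?n * Suc (t + 1) + 1) (S ?n)"
  proof (rule runs_while)
    show "scan (S k c) \<noteq> 0" if "k < ?n" for k
      using that w S[of k] nth_mem[of k w] by (metis scan_at_pos less_imp_le)
    show "runs (M ;; right_tm c) (S k) (t + 1) (S (Suc k))" if "k < ?n" for k
    proof (rule runs_seq)
      show "runs (right_tm c) ((S (Suc k))(c := at_pos w k)) 1 (S (Suc k))"
        by (rule runs_rightI) (use M that S[of "Suc k"] in \<open>auto simp: right_at_pos\<close>)
    qed (use run that M in simp_all)
    show "\<not> scan (S ?n c) \<noteq> 0" using S by (simp add: at_pos_def)
  qed (use M in simp_all)
  moreover have "runs (rewind_tm c) (S ?n) (2 * ?n + 3) ((S ?n)(c := ([0], w @ [])))"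
    using M w S[of ?n] by (intro runs_rewind) (simp_all add: at_pos_def)
  ultimately have "runs (for_tm c M) (S 0) ((?n * Suc (t + 1) + 1) + (2 * ?n + 3)) ((S ?n)(c := ([0], w)))"
    unfolding for_tm_def using M by (intro runs_seq) simp_all
  then show ?thesis by (rule runs_mono) (simp add: algebra_simps)
qed

section \<open>Programs that read one tape and append to another\<close>

text \<open>The tapes \<open>i\<close> (read) and \<open>j\<close> (written at its right end) of \<open>s\<close> are irrelevant; all other tapes are restored.\<close>

definition transfers ::
    "turing_machine \<Rightarrow> store \<Rightarrow> nat \<Rightarrow> nat \<Rightarrow> nat list \<Rightarrow> nat list \<Rightarrow> nat \<Rightarrow> bool" where
  "transfers M s i j u v t \<longleftrightarrow> (\<forall>l r l'.
     runs M (s(i := (l, u @ r), j := (l', []))) t (s(i := (rev u @ l, r), j := (rev v @ l', []))))"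

lemma transfers_cong:
  "transfers M s i j u v t \<Longrightarrow> u = u' \<Longrightarrow> v = v' \<Longrightarrow> t \<le> t' \<Longrightarrow> transfers M s i j u' v' t'"
  unfolding transfers_def using runs_mono by blast

lemma transfers_seq:
  assumes "is_program M" "is_program N"
    and "transfers M s i j u v t" "transfers N s i j u' v' t'"
  shows "transfers (M ;; N) s i j (u @ u') (v @ v') (t + t')"
  unfolding transfers_def
proof (intro allI)
  fix l r l'
  have "runs M (s(i := (l, u @ u' @ r), j := (l', []))) t
      (s(i := (rev u @ l, u' @ r), j := (rev v @ l', [])))"
    using assms(3) by (simp add: transfers_def)
  moreover have "runs N (s(i := (rev u @ l, u' @ r), j := (rev v @ l', []))) t'
      (s(i := (rev u' @ rev u @ l, r), j := (rev v' @ rev v @ l', [])))"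
    using assms(4) by (simp add: transfers_def)
  ultimately show "runs (M ;; N) (s(i := (l, (u @ u') @ r), j := (l', []))) (t + t')
      (s(i := (rev (u @ u') @ l, r), j := (rev (v @ v') @ l', [])))"
    using runs_seq assms(1,2) by simp
qed

lemma transfers_if:
  assumes "is_program M" "is_program N" "c < tape_num" "c \<noteq> i" "c \<noteq> j"
    and "scan (s c) = a \<Longrightarrow> transfers M s i j u v t" "scan (s c) \<noteq> a \<Longrightarrow> transfers N s i j u v t"
  shows "transfers (if_tm c a M N) s i j u v (Suc t)"
  using assms unfolding transfers_def by (auto intro!: runs_if)

lemma transfers_put: "j < tape_num \<Longrightarrow> transfers (put_tm j a) s i j [] [a] 1"
  unfolding transfers_def
  by (intro allI, rule runs_putI[where r = "[]"]) simp_all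

definition loop_time :: "nat \<Rightarrow> nat \<Rightarrow> nat" where
  "loop_time N t = N * (t + 4) + 4"

definition mark_time :: "nat \<Rightarrow> nat \<Rightarrow> nat" where
  "mark_time N t = N * (t + 4 * N + 7) + 4"

text \<open>After \<open>k\<close> rounds the words \<open>u 0\<close>, ...,
  \<open>u (k - 1)\<close> lie left of the head on tape \<open>i\<close> and \<open>v 0\<close>,
  ..., \<open>v (k - 1)\<close> have been appended on tape \<open>j\<close>. The counter may be any
  word without blanks, in particular a marked one.\<close>

lemma transfers_for:
  assumes M: "is_program M" "c < tape_num" and c: "c \<noteq> i" "c \<noteq> j" "s c = ([0], w)" "0 \<notin> set w"
    and n: "length w = n" "n \<le> N"
    and body: "\<And>k. k < n \<Longrightarrow> transfers M (s(c := at_pos w k)) i j (u k) (v k) t"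
  shows "transfers (for_tm c M) s i j (concat (map u [0..<n])) (concat (map v [0..<n])) (loop_time N t)"
  unfolding transfers_def loop_time_def
proof (intro allI)
  fix l r l'
  let ?u = "\<lambda>k k'. concat (map u [k..<k'])" and ?v = "\<lambda>k. concat (map v [0..<k])"
  define S where
    "S k = s(c := at_pos w k, i := (rev (?u 0 k) @ l, ?u k n @ r), j := (rev (?v k) @ l', []))" for k
  have "runs (for_tm c M) (S 0) (length w * (t + 4) + 4) ((S (length w))(c := ([0], w)))"
  proof (rule runs_for)
    show "runs M (S k) t ((S (Suc k))(c := at_pos w k))" if "k < length w" for k
    proof -
      have k: "k < n" using that n by simp
      show ?thesis
        using body[OF k, unfolded transfers_def, rule_format, of "rev (?u 0 k) @ l" "?u (Suc k) n @ r" "rev (?v k) @ l'"]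
        by (elim runs_cong) (use c k in \<open>auto simp: S_def fun_eq_iff upt_conv_Cons[of k n]\<close>)
    qed
  qed (use M c in \<open>auto simp: S_def\<close>)
  then show "runs (for_tm c M) (s(i := (l, ?u 0 n @ r), j := (l', []))) (N * (t + 4) + 4)
      (s(i := (rev (?u 0 n) @ l, r), j := (rev (?v n) @ l', [])))"
    by (rule runs_cong) (use n c in \<open>auto simp: S_def fun_eq_iff at_pos_def\<close>)
qed

lemma runs_copy_loop:
  assumes ij: "i < tape_num" "j < tape_num" "i \<noteq> j" and w: "Sym_end \<notin> set w"
  shows "runs (while_tm i (\<lambda>a. a \<noteq> Sym_end) (copy_tm i j ;; right_tm i))
    (s(i := (l, w @ Sym_end # r), j := (l', []))) (length w * 3 + 1)
    (s(i := (rev w @ l, Sym_end # r), j := (rev w @ l', [])))"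
proof -
  define S where "S k = s(i := (rev (take k w) @ l, drop k w @ Sym_end # r), j := (rev (take k w) @ l', []))" for k
  have scan: "scan (S k i) = w ! k" if "k < length w" for k
    using that ij by (simp add: S_def flip: Cons_nth_drop_Suc)
  have "runs (while_tm i (\<lambda>a. a \<noteq> Sym_end) (copy_tm i j ;; right_tm i)) (S 0) (length w * Suc (1 + 1) + 1) (S (length w))"
  proof (rule runs_while)
    show "scan (S k i) \<noteq> Sym_end" if "k < length w" for k
      using scan[OF that] that w nth_mem[OF that] by (auto simp del: nth_mem)
    show "runs (copy_tm i j ;; right_tm i) (S k) (1 + 1) (S (Suc k))" if k: "k < length w" for k
    proof (rule runs_seq)
      show "runs (copy_tm i j) (S k) 1 ((S k)(j := (w ! k # rev (take k w) @ l', [])))"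
        by (rule runs_copyI) (use scan[OF k] ij k in \<open>auto simp: S_def\<close>)
      show "runs (right_tm i) ((S k)(j := (w ! k # rev (take k w) @ l', []))) 1 (S (Suc k))"
        by (rule runs_rightI)
           (use ij k in \<open>auto simp: S_def fun_eq_iff take_Suc_conv_app_nth simp flip: Cons_nth_drop_Suc\<close>)
    qed (use ij in simp_all)
    show "\<not> scan (S (length w) i) \<noteq> Sym_end" using ij by (simp add: S_def)
  qed (use ij in simp_all)
  then show ?thesis by (rule runs_cong) (simp_all add: S_def)
qed

lemma transfers_copy_word:
  assumes ij: "i < tape_num" "j < tape_num" "i \<noteq> j" and w: "Sym_end \<notin> set w" "length w \<le> N"
  shows "transfers (copy_word_tm i j) s i j (w @ [Sym_end]) w (3 * N + 2)"
  unfolding transfers_def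
proof (intro allI)
  fix l r l'
  let ?s = "s(i := (rev w @ l, Sym_end # r), j := (rev w @ l', []))"
  have "runs (copy_word_tm i j) (s(i := (l, w @ Sym_end # r), j := (l', []))) ((length w * 3 + 1) + 1)
      (?s(i := right (?s i)))"
    unfolding copy_word_tm_def
    by (intro runs_seq[OF _ runs_copy_loop] runs_right) (use ij w in simp_all)
  then show "runs (copy_word_tm i j) (s(i := (l, (w @ [Sym_end]) @ r), j := (l', []))) (3 * N + 2)
      (s(i := (rev (w @ [Sym_end]) @ l, r), j := (rev w @ l', [])))"
    by (rule runs_cong) (use ij w in \<open>auto simp: fun_eq_iff\<close>)
qed

lemma transfers_copy_token:
  assumes ij: "i < tape_num" "j < tape_num" "i \<noteq> j" and w: "Sym_end \<notin> set w" "length w \<le> N"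
  shows "transfers (copy_token_tm i j) s i j (w @ [Sym_end]) (w @ [Sym_end]) (3 * N + 3)"
  unfolding transfers_def
proof (intro allI)
  fix l r l'
  let ?s = "s(i := (rev w @ l, Sym_end # r), j := (rev w @ l', []))"
  let ?s' = "?s(j := (Sym_end # rev w @ l', []))"
  have "runs (copy_tm i j) ?s 1 ?s'"
    by (rule runs_copyI) (use ij in auto)
  then have "runs (copy_token_tm i j) (s(i := (l, w @ Sym_end # r), j := (l', []))) ((length w * 3 + 1) + (1 + 1))
      (?s'(i := right (?s' i)))"
    unfolding copy_token_tm_def
    by (intro runs_seq[OF _ runs_copy_loop] runs_seq[where s' = ?s'] runs_right) (use ij w in simp_all)
  then show "runs (copy_token_tm i j) (s(i := (l, (w @ [Sym_end]) @ r), j := (l', []))) (3 * N + 3)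
      (s(i := (rev (w @ [Sym_end]) @ l, r), j := (rev (w @ [Sym_end]) @ l', [])))"
    by (rule runs_cong) (use ij w in \<open>auto simp: fun_eq_iff\<close>)
qed

text \<open>The predicate is kept general for its two uses, moving to a \<open>Sym_end\<close> and
  moving over the symbols \<open>Sym_1\<close> before a mark. Scanning ignores the left part of a
  tape, hence the arbitrary \<open>l'\<close>.\<close>

lemma runs_skip_loop:
  assumes i: "i < tape_num" "s i = (l, w @ r)" and w: "\<And>a. a \<in> set w \<Longrightarrow> p a" "\<not> p (scan (l', r))"
  shows "runs (while_tm i p (right_tm i)) s (length w * 2 + 1) (s(i := (rev w @ l, r)))"
proof -
  define S where "S k = s(i := (rev (take k w) @ l, drop k w @ r))" for k
  have "runs (while_tm i p (right_tm i)) (S 0) (length w * Suc 1 + 1) (S (length w))"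
  proof (rule runs_while)
    show "p (scan (S k i))" if "k < length w" for k
      using that w by (simp add: S_def flip: Cons_nth_drop_Suc)
    show "runs (right_tm i) (S k) 1 (S (Suc k))" if "k < length w" for k
      by (rule runs_rightI)
         (use i that in \<open>auto simp: S_def take_Suc_conv_app_nth simp flip: Cons_nth_drop_Suc\<close>)
    show "\<not> p (scan (S (length w) i))" using w(2) by (simp add: S_def scan_def)
  qed (use i in simp_all)
  then show ?thesis by (rule runs_cong) (use i in \<open>simp_all add: S_def fun_upd_idem\<close>)
qed

lemma transfers_skip_token:
  assumes ij: "i < tape_num" "i \<noteq> j" and w: "Sym_end \<notin> set w" "length w \<le> N"
  shows "transfers (skip_token_tm i) s i j (w @ [Sym_end]) [] (2 * N + 2)"
  unfolding transfers_def
proof (intro allI)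
  fix l r l'
  let ?s = "s(i := (l, w @ Sym_end # r), j := (l', []))"
  let ?s' = "?s(i := (rev w @ l, Sym_end # r))"
  have "runs (skip_token_tm i) ?s ((length w * 2 + 1) + 1) (?s'(i := right (?s' i)))"
    unfolding skip_token_tm_def
    by (intro runs_seq[where s' = ?s'] runs_skip_loop[where l' = "[]"] runs_right) (use ij w in auto)
  then show "runs (skip_token_tm i) (s(i := (l, (w @ [Sym_end]) @ r), j := (l', []))) (2 * N + 2)
      (s(i := (rev (w @ [Sym_end]) @ l, r), j := (rev [] @ l', [])))"
    by (rule runs_cong) (use ij w in \<open>auto simp: fun_eq_iff\<close>)
qed

text \<open>The mark is not a blank, so a marked counter still drives loops of the same
  length.\<close>

definition marked :: "nat \<Rightarrow> nat \<Rightarrow> nat list" where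
  "marked m k = replicate k Sym_1 @ Sym_0 # replicate (m - Suc k) Sym_1"

lemma length_marked [simp]: "k < m \<Longrightarrow> length (marked m k) = m"
  by (simp add: marked_def)

lemma zero_notin_marked [simp]: "0 \<notin> set (marked m k)"
  by (simp add: marked_def)

lemma nth_marked: "k < m \<Longrightarrow> i < m \<Longrightarrow> marked m k ! i = (if i = k then Sym_0 else Sym_1)"
  by (auto simp: marked_def nth_append nth_Cons')

text \<open>The mark itself remembers the round: after the body it is the first symbol other than
  \<open>Sym_1\<close>, so overwriting it restores the counter and leaves the head at
  \<open>k + 1\<close>. Round \<open>k\<close> takes \<open>t + 4 * k + 8\<close> steps, which is at
  most \<open>t + 4 * m + 4\<close> as \<open>k < m\<close>; the tests and the last rewind add three
  steps per symbol and 4 overall, which gives \<open>mark_time\<close>.\<close>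

lemma transfers_mark_each:
  assumes M: "is_program M" "c < tape_num" and c: "c \<noteq> i" "c \<noteq> j" "s c = ([0], replicate m Sym_1)"
    and N: "m \<le> N"
    and body: "\<And>k. k < m \<Longrightarrow> transfers M (s(c := ([0], marked m k))) i j (u k) (v k) t"
  shows "transfers (mark_each_tm c M) s i j (concat (map u [0..<m])) (concat (map v [0..<m]))
    (mark_time N t)"
  unfolding transfers_def mark_time_def
proof (intro allI)
  fix l r l'
  let ?u = "\<lambda>k k'. concat (map u [k..<k'])" and ?v = "\<lambda>k. concat (map v [0..<k])"
  let ?S = "\<lambda>k z. s(i := (rev (?u 0 k) @ l, ?u k m @ r), j := (rev (?v k) @ l', []), c := z)"
  define S where "S k = ?S k (replicate k Sym_1 @ [0], replicate (m - k) Sym_1)" for k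
  let ?B = "put_tm c Sym_0 ;; rewind_tm c ;; M ;; while_tm c (\<lambda>a. a = Sym_1) (right_tm c) ;; put_tm c Sym_1"
  have "runs (while_tm c (\<lambda>a. a \<noteq> 0) ?B) (S 0) (m * Suc (t + 4 * m + 4) + 1) (S m)"
  proof (rule runs_while)
    show "scan (S k c) \<noteq> 0" if "k < m" for k
      using that by (cases "m - k") (simp_all add: S_def)
    show "\<not> scan (S m c) \<noteq> 0" by (simp add: S_def)
    show "runs ?B (S k) (t + 4 * m + 4) (S (Suc k))" if k: "k < m" for k
    proof -
      let ?r = "replicate (m - Suc k) Sym_1"
      have mk: "m - k = Suc (m - Suc k)" using k by simp
      have put: "runs (put_tm c Sym_0) (S k) 1 (?S k (Sym_0 # replicate k Sym_1 @ [0], ?r))"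
        by (rule runs_putI[where l = "replicate k Sym_1 @ [0]" and r = "Sym_1 # ?r"]) (simp_all add: M S_def mk)
      have rew: "runs (rewind_tm c) (?S k (Sym_0 # replicate k Sym_1 @ [0], ?r)) (2 * k + 5)
          (?S k ([0], marked m k))"
        by (rule runs_rewindI[where w = "replicate k Sym_1 @ [Sym_0]" and r = ?r])
           (simp_all add: M marked_def)
      have M': "runs M (?S k ([0], marked m k)) t (?S (Suc k) ([0], marked m k))"
        using body[OF k, unfolded transfers_def, rule_format, of "rev (?u 0 k) @ l" "?u (Suc k) m @ r" "rev (?v k) @ l'"]
        by (elim runs_cong) (use c k in \<open>auto simp: fun_eq_iff upt_conv_Cons[of k m]\<close>)
      have skip: "runs (while_tm c (\<lambda>a. a = Sym_1) (right_tm c)) (?S (Suc k) ([0], marked m k)) (2 * k + 1)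
          (?S (Suc k) (replicate k Sym_1 @ [0], Sym_0 # ?r))"
        by (rule runs_cong[OF runs_skip_loop[OF M(2), of "?S (Suc k) ([0], marked m k)" "[0]"
                "replicate k Sym_1" "Sym_0 # ?r" _ "[]"]]) (simp_all add: marked_def)
      have put': "runs (put_tm c Sym_1) (?S (Suc k) (replicate k Sym_1 @ [0], Sym_0 # ?r)) 1 (S (Suc k))"
        by (rule runs_putI[where l = "replicate k Sym_1 @ [0]" and r = "Sym_0 # ?r"]) (simp_all add: M S_def)
      have "runs ?B (S k) (1 + ((2 * k + 5) + (t + ((2 * k + 1) + 1)))) (S (Suc k))"
        using put rew M' skip put' M by (intro runs_seq) simp_all
      then show ?thesis by (rule runs_mono) (use k in simp)
    qed
  qed (use M in simp_all)
  moreover have "runs (rewind_tm c) (S m) (2 * m + 3) ((S m)(c := ([0], replicate m Sym_1)))"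
    by (rule runs_rewindI[where w = "replicate m Sym_1" and r = "[]"]) (simp_all add: M S_def)
  ultimately have "runs (mark_each_tm c M) (S 0) ((m * Suc (t + 4 * m + 4) + 1) + (2 * m + 3))
      ((S m)(c := ([0], replicate m Sym_1)))"
    unfolding mark_each_tm_def using M by (intro runs_seq) simp_all
  moreover have "(m * Suc (t + 4 * m + 4) + 1) + (2 * m + 3) \<le> N * (t + 4 * N + 7) + 4"
  proof -
    have "m * (t + 4 * m + 7) \<le> N * (t + 4 * N + 7)" using N by (intro mult_le_mono) simp_all
    then show ?thesis by (simp add: algebra_simps)
  qed
  ultimately show "runs (mark_each_tm c M) (s(i := (l, ?u 0 m @ r), j := (l', []))) (N * (t + 4 * N + 7) + 4)
      (s(i := (rev (?u 0 m) @ l, r), j := (rev (?v m) @ l', [])))"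
    by (elim runs_cong) (use c in \<open>auto simp: S_def fun_eq_iff\<close>)
qed

text \<open>Rewinding \<open>e\<close> afterwards makes its word available again, so seen from tape
  \<open>i\<close> nothing is consumed. This is what allows a loop to write the same entries once
  for every copy of u.\<close>

lemma transfers_from:
  assumes M: "is_program M" "e < tape_num" "e \<noteq> i" "e \<noteq> j" "i \<noteq> j"
    and e: "s e = ([0], u)" "0 \<notin> set u" "length u \<le> N"
    and run: "\<And>z. transfers M (s(i := z)) e j u v t"
  shows "transfers (from_tm e M) s i j [] v (t + 2 * N + 3)"
  unfolding transfers_def
proof (intro allI)
  fix l r l'
  let ?s = "s(i := (l, r), j := (rev v @ l', []))"
  have "runs M (s(i := (l, r), j := (l', []))) t (?s(e := (rev u @ [0], [])))"
    using run[of "(l, r)", unfolded transfers_def, rule_format, of "[0]" "[]" l']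
    by (rule runs_cong) (use M e in \<open>auto simp: fun_eq_iff\<close>)
  moreover have "runs (rewind_tm e) (?s(e := (rev u @ [0], []))) (2 * length u + 3) ?s"
    by (rule runs_rewindI[where w = u and r = "[]"]) (use M e in \<open>auto simp: fun_eq_iff\<close>)
  ultimately have "runs (from_tm e M) (s(i := (l, r), j := (l', []))) (t + (2 * length u + 3)) ?s"
    unfolding from_tm_def using M by (intro runs_seq) simp_all
  then show "runs (from_tm e M) (s(i := (l, [] @ r), j := (l', []))) (t + 2 * N + 3)
      (s(i := (rev [] @ l, r), j := (rev v @ l', [])))"
    by (rule runs_cong) (use e in auto)
qed

text \<open>Loading fills a work tape for good, while \<open>transfers\<close> demands that all
  tapes but two are restored; here the store may change from \<open>s\<close> to
  \<open>s'\<close>.\<close>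

definition loads :: "turing_machine \<Rightarrow> store \<Rightarrow> nat list \<Rightarrow> store \<Rightarrow> nat \<Rightarrow> bool" where
  "loads M s u s' t \<longleftrightarrow> (\<forall>l r. runs M (s(0 := (l, u @ r))) t (s'(0 := (rev u @ l, r))))"

lemma loads_seq:
  assumes "is_program M" "is_program N" "loads M s u s' t" "loads N s' u' s'' t'"
  shows "loads (M ;; N) s (u @ u') s'' (t + t')"
  unfolding loads_def
proof (intro allI)
  fix l r
  have "runs M (s(0 := (l, u @ u' @ r))) t (s'(0 := (rev u @ l, u' @ r)))"
    using assms(3) by (simp add: loads_def)
  moreover have "runs N (s'(0 := (rev u @ l, u' @ r))) t' (s''(0 := (rev u' @ rev u @ l, r)))"
    using assms(4) by (simp add: loads_def)
  ultimately show "runs (M ;; N) (s(0 := (l, (u @ u') @ r))) (t + t') (s''(0 := (rev (u @ u') @ l, r)))"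
    using assms(1,2) by (simp add: runs_seq)
qed

lemma loads_load:
  assumes M: "is_program M" "0 < j" "j < tape_num" and s: "s j = ([], [])"
    and v: "0 \<notin> set v" "length v \<le> N" and run: "transfers M s 0 j u v t"
  shows "loads (load_tm j M) s u (s(j := ([0], v))) (t + 2 * N + 4)"
  unfolding loads_def
proof (intro allI)
  fix l r
  have "runs (right_tm j) (s(0 := (l, u @ r))) 1 (s(0 := (l, u @ r), j := ([0], [])))"
    by (rule runs_rightI) (use M s in auto)
  moreover have "runs M (s(0 := (l, u @ r), j := ([0], []))) t (s(0 := (rev u @ l, r), j := (rev v @ [0], [])))"
    using run by (simp add: transfers_def)
  moreover have "runs (rewind_tm j) (s(0 := (rev u @ l, r), j := (rev v @ [0], []))) (2 * length v + 3)
      (s(0 := (rev u @ l, r), j := ([0], v)))"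
    by (rule runs_rewindI[where w = v and r = "[]"]) (use M v in auto)
  ultimately have "runs (load_tm j M) (s(0 := (l, u @ r))) (1 + (t + (2 * length v + 3)))
      (s(0 := (rev u @ l, r), j := ([0], v)))"
    unfolding load_tm_def using M by (intro runs_seq) simp_all
  then show "runs (load_tm j M) (s(0 := (l, u @ r))) (t + 2 * N + 4)
      (s(j := ([0], v), 0 := (rev u @ l, r)))"
    by (rule runs_cong) (use v M in \<open>auto simp: fun_eq_iff\<close>)
qed

section \<open>Codes\<close>

abbreviation cat :: "nat \<Rightarrow> (nat \<Rightarrow> nat list) \<Rightarrow> nat list" where
  "cat n f \<equiv> concat (map f [0..<n])"

lemma cat_empty [simp]: "concat (map (\<lambda>_. []) xs) = []"
  by (induction xs) simp_all

lemma cat_cong: "(\<And>i. i < n \<Longrightarrow> f i = g i) \<Longrightarrow> cat n f = cat n g"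
  by (intro arg_cong[of _ _ concat] map_cong) simp_all

text \<open>Serves to show that a row of blocks of the new B uses up exactly one row of the old
  B.\<close>

lemma cat_single: "k < n \<Longrightarrow> cat n (\<lambda>j. if j = k then x else []) = x"
proof (induction n)
  case (Suc n)
  show ?case
  proof (cases "k = n")
    case True
    then have "cat n (\<lambda>j. if j = k then x else []) = cat n (\<lambda>_. [])" by (intro cat_cong) simp
    then show ?thesis using True by simp
  qed (use Suc in simp)
qed simp

lemma cat_replicate: "cat m (\<lambda>_. replicate n a) = replicate (m * n) a"
  by (induction m) (simp_all add: replicate_add[symmetric] add.commute)

lemma cat_add: "cat (m + n) f = cat m f @ cat n (\<lambda>i. f (m + i))"
  by (induction n) simp_all

text \<open>Turns a flat enumeration of \<open>m * n\<close> indices, as in the new instance, into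
  nested loops over the old dimensions, which is the form that the machine executes.\<close>

lemma cat_mult: "cat (m * n) f = cat m (\<lambda>i. cat n (\<lambda>j. f (i * n + j)))"
proof (induction m)
  case (Suc m)
  have "cat (Suc m * n) f = cat (m * n + n) f" by (simp add: add.commute)
  then show ?case using Suc by (simp only: cat_add) simp
qed simp

lemma block_index_less: "k * q + i < p * q" if "k < p" "i < q" for k i p q :: nat
proof -
  have "k * q + i < Suc k * q" using that by simp
  also have "\<dots> \<le> p * q" using that by (intro mult_le_mono1) simp
  finally show ?thesis .
qed

lemma length_cat: "i < n \<Longrightarrow> length (f i) \<le> length (cat n f)"
  by (induction n) (auto simp: less_Suc_eq)

lemma set_cat: "set (cat n f) = (\<Union>i<n. set (f i))"
  by auto

lemma encode_mat_cat:
  "encode_mat C = encode_dim (dim_row C) @ encode_dim (dim_col C) @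
     cat (dim_row C) (\<lambda>i. cat (dim_col C) (\<lambda>j. encode_rat (C $$ (i, j))))"
proof -
  have "concat (concat xs) = concat (map concat xs)" for xs :: "nat list list list"
    by (induction xs) simp_all
  then show ?thesis by (simp add: encode_mat_def mat_to_list_def map_concat o_def)
qed

lemma encode_vec_cat:
  "encode_vec v = encode_dim (dim_vec v) @ cat (dim_vec v) (\<lambda>i. encode_rat (v $ i))"
proof -
  have "list_of_vec v = map (($) v) [0..<dim_vec v]"
    by (rule nth_equalityI) (simp_all add: list_of_vec_index)
  then show ?thesis by (simp add: encode_vec_def o_def)
qed

text \<open>The unit moved by the machine: its end is recognized by the only \<open>Sym_end\<close>,
  and its inside is never interpreted.\<close>

definition is_token :: "nat list \<Rightarrow> bool" where
  "is_token x \<longleftrightarrow> (\<exists>w. x = w @ [Sym_end] \<and> set w \<subseteq> {0<..<Sym_end})"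

lemma is_token_encode_nat: "is_token (encode_nat n @ [Sym_end])"
  using set_encode_nat[of n] by (auto simp: is_token_def)

lemma is_token_encode_rat: "is_token (encode_rat x)"
proof -
  obtain p q where "quotient_of x = (p, q)" by fastforce
  then have "encode_rat x = (encode_int p @ [Sym_slash] @ encode_nat (nat q)) @ [Sym_end]"
    by (simp add: encode_rat_def)
  moreover have "set (encode_int p @ [Sym_slash] @ encode_nat (nat q)) \<subseteq> {0<..<Sym_end}"
    using set_encode_nat[of "nat q"] set_encode_nat[of "nat \<bar>p\<bar>"] by (auto simp: encode_int_def)
  ultimately show ?thesis unfolding is_token_def by blast
qed

text \<open>Zero, written as 0/1, is the only number in the output that need not occur in the
  input.\<close>

lemma encode_rat_0: "encode_rat 0 = [Sym_0, Sym_slash, Sym_1, Sym_end]"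
  by (simp add: encode_rat_def encode_int_def encode_nat.simps[of 0] encode_nat.simps[of "Suc 0"])

lemma set_token: "is_token x \<Longrightarrow> set x \<subseteq> {0<..<sym_num}"
  by (force simp: is_token_def)

lemma set_encode_dim: "set (encode_dim n) \<subseteq> {0<..<sym_num}"
  by (auto simp: encode_dim_def)

lemma set_encode_rat: "set (encode_rat x) \<subseteq> {0<..<sym_num}"
  by (intro set_token is_token_encode_rat)

lemma set_encode_mat: "set (encode_mat C) \<subseteq> {0<..<sym_num}"
  using set_encode_dim set_encode_rat unfolding encode_mat_cat set_append set_cat by blast

lemma set_encode_vec: "set (encode_vec v) \<subseteq> {0<..<sym_num}"
  using set_encode_dim set_encode_rat unfolding encode_vec_cat set_append set_cat by blast

lemma set_encode_instance: "set (encode_instance I) \<subseteq> {0<..<sym_num}"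
proof -
  have "set (concat (map encode_mat (T_mats I))) \<subseteq> {0<..<sym_num}"
    using set_encode_mat by fastforce
  then show ?thesis
    using set_encode_dim set_encode_mat set_encode_vec set_token[OF is_token_encode_nat]
    unfolding encode_instance_def set_append by (intro Un_least) auto
qed


section \<open>The reduction\<close>

text \<open>Coordinate \<open>l\<close> of the new uncertain vector is coordinate
  \<open>l mod n\<close> of copy \<open>l div n\<close>; rows of the new B are decoded in the same
  way with \<open>r\<close>. Coefficient matrix \<open>l\<close> keeps only row
  \<open>l div n\<close> of the old matrix \<open>l mod n\<close>, the row for which this copy is
  meant.\<close>

definition split_rows :: "adapt_instance \<Rightarrow> adapt_instance" where
  "split_rows I =
     (let m = m_y I; n = n_u I; r = dim_row (B_mat I) in
      \<lparr>R_bound = R_bound I, A_mat = A_mat I, a_vec = a_vec I,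
       B_mat = mat (m * r) (m * n)
         (\<lambda>(i, j). if i div r = j div n then B_mat I $$ (i mod r, j mod n) else 0),
       b_vec = vec (m * r) (\<lambda>i. b_vec I $ (i mod r)),
       W_mat = W_mat I,
       T_mats = map (\<lambda>l. mat m (n_x I) (\<lambda>(i, j). if i = l div n then (T_mats I ! (l mod n)) $$ (i, j) else 0))
         [0..<m * n]\<rparr>)"

lemma wf_split_rows: "wf_instance I \<Longrightarrow> wf_instance (split_rows I)"
  by (auto simp: wf_instance_def split_rows_def Let_def n_u_def m_y_def n_x_def)

lemma encode_instance_cat:
  assumes "wf_instance I"
  shows "encode_instance I = (encode_nat (R_bound I) @ [Sym_end]) @
    encode_dim (dim_row (A_mat I)) @ encode_dim (n_x I) @
    cat (dim_row (A_mat I)) (\<lambda>i. cat (n_x I) (\<lambda>j. encode_rat (A_mat I $$ (i, j)))) @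
    encode_dim (dim_row (A_mat I)) @ cat (dim_row (A_mat I)) (\<lambda>i. encode_rat (a_vec I $ i)) @
    encode_dim (dim_row (B_mat I)) @ encode_dim (n_u I) @
    cat (dim_row (B_mat I)) (\<lambda>i. cat (n_u I) (\<lambda>j. encode_rat (B_mat I $$ (i, j)))) @
    encode_dim (dim_row (B_mat I)) @ cat (dim_row (B_mat I)) (\<lambda>i. encode_rat (b_vec I $ i)) @
    encode_dim (m_y I) @ encode_dim (n_y I) @
    cat (m_y I) (\<lambda>i. cat (n_y I) (\<lambda>j. encode_rat (W_mat I $$ (i, j)))) @
    encode_dim (n_u I) @
    cat (n_u I) (\<lambda>k. encode_dim (m_y I) @ encode_dim (n_x I) @
      cat (m_y I) (\<lambda>i. cat (n_x I) (\<lambda>j. encode_rat (T_mats I ! k $$ (i, j)))))"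
proof -
  have T: "T_mats I ! k \<in> carrier_mat (m_y I) (n_x I)" if "k < n_u I" for k
    using assms that nth_mem[of k "T_mats I"] by (auto simp: wf_instance_def simp del: nth_mem)
  have "concat (map encode_mat (T_mats I)) = cat (n_u I) (\<lambda>k. encode_mat (T_mats I ! k))"
    using assms map_nth[of "T_mats I"] by (metis (no_types, lifting) map_map o_def map_cong wf_instance_def)
  also have "\<dots> = cat (n_u I) (\<lambda>k. encode_dim (m_y I) @ encode_dim (n_x I) @
      cat (m_y I) (\<lambda>i. cat (n_x I) (\<lambda>j. encode_rat (T_mats I ! k $$ (i, j)))))"
    by (intro cat_cong) (use T in \<open>simp add: encode_mat_cat carrier_matD[OF T]\<close>)
  finally show ?thesis
    using assms by (simp add: encode_instance_def encode_mat_cat encode_vec_cat wf_instance_def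
        n_x_def n_u_def m_y_def n_y_def)
qed

text \<open>Splitting the flat indices by \<open>cat_mult\<close> makes \<open>div\<close> and
  \<open>mod\<close> disappear: a block or row is copied when two loop indices agree and is zero
  otherwise, a test that a machine makes with a marked counter.\<close>

lemma encode_split_rows:
  fixes I
  defines "m \<equiv> m_y I" and "n \<equiv> n_u I" and "r \<equiv> dim_row (B_mat I)"
  assumes wf: "wf_instance I"
  shows "encode_instance (split_rows I) = (encode_nat (R_bound I) @ [Sym_end]) @
    encode_dim (dim_row (A_mat I)) @ encode_dim (n_x I) @
    cat (dim_row (A_mat I)) (\<lambda>i. cat (n_x I) (\<lambda>j. encode_rat (A_mat I $$ (i, j)))) @
    encode_dim (dim_row (A_mat I)) @ cat (dim_row (A_mat I)) (\<lambda>i. encode_rat (a_vec I $ i)) @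
    encode_dim (m * r) @ encode_dim (m * n) @
    cat m (\<lambda>k. cat r (\<lambda>i. cat m (\<lambda>l. cat n (\<lambda>j. if l = k then encode_rat (B_mat I $$ (i, j)) else encode_rat 0)))) @
    encode_dim (m * r) @ cat m (\<lambda>k. cat r (\<lambda>i. encode_rat (b_vec I $ i))) @
    encode_dim m @ encode_dim (n_y I) @
    cat m (\<lambda>i. cat (n_y I) (\<lambda>j. encode_rat (W_mat I $$ (i, j)))) @
    encode_dim (m * n) @
    cat m (\<lambda>k. cat n (\<lambda>l. encode_dim m @ encode_dim (n_x I) @
      cat m (\<lambda>i. cat (n_x I) (\<lambda>j. if i = k then encode_rat (T_mats I ! l $$ (i, j)) else encode_rat 0))))"
proof -
  let ?I = "split_rows I"
  have dims: "dim_row (A_mat ?I) = dim_row (A_mat I)" "n_x ?I = n_x I" "dim_row (B_mat ?I) = m * r"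
    "n_u ?I = m * n" "m_y ?I = m" "n_y ?I = n_y I"
    by (simp_all add: split_rows_def Let_def n_x_def n_u_def m_y_def n_y_def m_def n_def r_def)
  have B: "cat (m * r) (\<lambda>i. cat (m * n) (\<lambda>j. encode_rat (B_mat ?I $$ (i, j)))) =
    cat m (\<lambda>k. cat r (\<lambda>i. cat m (\<lambda>l. cat n (\<lambda>j. if l = k then encode_rat (B_mat I $$ (i, j)) else encode_rat 0))))"
    unfolding cat_mult
    by (intro cat_cong) (auto simp: split_rows_def Let_def block_index_less simp flip: m_def n_def r_def)
  have b: "cat (m * r) (\<lambda>i. encode_rat (b_vec ?I $ i)) = cat m (\<lambda>k. cat r (\<lambda>i. encode_rat (b_vec I $ i)))"
    unfolding cat_mult
    by (intro cat_cong) (auto simp: split_rows_def Let_def block_index_less simp flip: m_def n_def r_def)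
  have T: "cat (m * n) (\<lambda>k. encode_dim m @ encode_dim (n_x I) @
      cat m (\<lambda>i. cat (n_x I) (\<lambda>j. encode_rat (T_mats ?I ! k $$ (i, j))))) =
    cat m (\<lambda>k. cat n (\<lambda>l. encode_dim m @ encode_dim (n_x I) @
      cat m (\<lambda>i. cat (n_x I) (\<lambda>j. if i = k then encode_rat (T_mats I ! l $$ (i, j)) else encode_rat 0))))"
    unfolding cat_mult[where m = m and n = n]
    by (intro cat_cong arg_cong2[of _ _ _ _ "(@)"] refl)
       (auto simp: split_rows_def Let_def block_index_less simp flip: m_def n_def r_def)
  have "R_bound ?I = R_bound I" "A_mat ?I = A_mat I" "a_vec ?I = a_vec I" "W_mat ?I = W_mat I"
    by (simp_all add: split_rows_def Let_def)
  then show ?thesis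
    unfolding encode_instance_cat[OF wf_split_rows[OF wf]] dims B b T by simp
qed

section \<open>Correctness of the reduction\<close>

definition block :: "nat \<Rightarrow> 'a vec \<Rightarrow> nat \<Rightarrow> 'a vec" where
  "block n u i = vec n (\<lambda>k. u $ (i * n + k))"

lemma dim_block [simp]: "dim_vec (block n u i) = n"
  by (simp add: block_def)

lemma div_mod_less:
  fixes l :: nat
  assumes "l < m * n"
  shows "l div n < m" "l mod n < n"
  using assms by (auto simp: less_mult_imp_div_less intro!: mod_less_divisor gr0I)

lemma sum_blocks:
  fixes g :: "nat \<Rightarrow> 'a :: comm_monoid_add"
  shows "(\<Sum>l<m * n. g l) = (\<Sum>p<m. \<Sum>q<n. g (p * n + q))"
proof (induction m)
  case (Suc m)
  have split: "(\<Sum>l<a + n. g l) = (\<Sum>l<a. g l) + (\<Sum>q<n. g (a + q))" for a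
    by (induction n) (simp_all add: add.assoc)
  have "(\<Sum>l<Suc m * n. g l) = (\<Sum>l<m * n + n. g l)" by (simp add: add.commute)
  also have "\<dots> = (\<Sum>l<m * n. g l) + (\<Sum>q<n. g (m * n + q))"
    by (rule split)
  finally show ?case using Suc by simp
qed simp

lemma mult_mat_vec_index:
  "i < dim_row A \<Longrightarrow> dim_col A = dim_vec v \<Longrightarrow> (A *\<^sub>v v) $ i = (\<Sum>j<dim_vec v. A $$ (i, j) * v $ j)"
  by (simp add: scalar_prod_def lessThan_atLeast0)

lemma split_rows_simps [simp]:
  "R_bound (split_rows I) = R_bound I" "n_x (split_rows I) = n_x I" "n_y (split_rows I) = n_y I"
  "m_y (split_rows I) = m_y I" "W_mat (split_rows I) = W_mat I" "n_u (split_rows I) = m_y I * n_u I"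
  "dim_row (B_mat (split_rows I)) = m_y I * dim_row (B_mat I)"
  "dim_vec (b_vec (split_rows I)) = m_y I * dim_row (B_mat I)"
  "A_mat (split_rows I) = A_mat I" "a_vec (split_rows I) = a_vec I"
  by (simp_all add: split_rows_def Let_def n_x_def n_u_def m_y_def n_y_def)

lemma X_set_split_rows: "X_set c (split_rows I) = X_set c I"
  by (simp add: X_set_def)

lemma all_blocks: "(\<forall>l<m * n. P l) \<longleftrightarrow> (\<forall>i<m. \<forall>k<n. P (i * n + k))" for m n :: nat
proof (intro iffI allI impI)
  fix l assume *: "\<forall>i<m. \<forall>k<n. P (i * n + k)" and l: "l < m * n"
  have "P (l div n * n + l mod n)" using * div_mod_less[OF l] by blast
  then show "P l" by simp
next
  fix i k assume *: "\<forall>l<m * n. P l" and ik: "i < m" "k < n"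
  show "P (i * n + k)" using *[rule_format, OF block_index_less[OF ik]] .
qed

lemma box_points_blocks:
  assumes "u \<in> carrier_vec (m * n)"
  shows "u \<in> box_points c R (m * n) \<longleftrightarrow> (\<forall>i<m. block n u i \<in> box_points c R n)"
proof -
  let ?P = "\<lambda>l. 0 \<le> u $ l \<and> u $ l \<le> real R \<and> (c = Discrete \<longrightarrow> u $ l \<in> \<int>)"
  have "block n u i \<in> box_points c R n \<longleftrightarrow> (\<forall>k<n. ?P (i * n + k))" for i
    by (simp add: box_points_def block_def)
  then show ?thesis using assms all_blocks[of m n ?P] by (simp add: box_points_def)
qed

text \<open>Row \<open>k\<close> of block row \<open>i\<close> vanishes outside the diagonal block,
  so only block \<open>i\<close> of \<open>u\<close> survives in the product.\<close>

lemma mult_B_split_rows: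
  assumes "i < m_y I" "k < dim_row (B_mat I)" "dim_vec u = m_y I * n_u I"
  shows "(map_mat real_of_rat (B_mat (split_rows I)) *\<^sub>v u) $ (i * dim_row (B_mat I) + k) =
    (map_mat real_of_rat (B_mat I) *\<^sub>v block (n_u I) u i) $ k"
proof -
  let ?n = "n_u I" and ?r = "dim_row (B_mat I)" and ?m = "m_y I"
  have lt: "i * ?r + k < ?m * ?r" by (rule block_index_less) (use assms in auto)
  have cols: "dim_col (B_mat (split_rows I)) = ?m * ?n" by (simp add: split_rows_def Let_def)
  have "(map_mat real_of_rat (B_mat (split_rows I)) *\<^sub>v u) $ (i * ?r + k) =
      (\<Sum>l<?m * ?n. real_of_rat (B_mat (split_rows I) $$ (i * ?r + k, l)) * u $ l)"
    using lt assms(3) by (subst mult_mat_vec_index) (simp_all add: cols)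
  also have "\<dots> = (\<Sum>l<?m * ?n. if i = l div ?n then real_of_rat (B_mat I $$ (k, l mod ?n)) * u $ l else 0)"
    using lt assms(2) by (intro sum.cong) (auto simp: split_rows_def Let_def)
  also have "\<dots> = (\<Sum>p<?m. \<Sum>q<?n. if i = p then real_of_rat (B_mat I $$ (k, q)) * u $ (p * ?n + q) else 0)"
    by (subst sum_blocks, intro sum.cong) auto
  also have "\<dots> = (\<Sum>p<?m. if i = p then \<Sum>q<?n. real_of_rat (B_mat I $$ (k, q)) * u $ (p * ?n + q) else 0)"
    by (intro sum.cong) auto
  also have "\<dots> = (\<Sum>q<?n. real_of_rat (B_mat I $$ (k, q)) * u $ (i * ?n + q))"
    using assms(1) by simp
  also have "\<dots> = (map_mat real_of_rat (B_mat I) *\<^sub>v block ?n u i) $ k"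
    using assms(2) by (subst mult_mat_vec_index) (auto simp: n_u_def block_def intro!: sum.cong)
  finally show ?thesis .
qed

text \<open>The new uncertainty set is the \<open>m_y I\<close>-fold product of the old one: box,
  integrality and linear constraints all split over the blocks.\<close>

lemma U_set_split_rows:
  assumes "wf_instance I" and u: "u \<in> carrier_vec (m_y I * n_u I)"
  shows "u \<in> U_set c (split_rows I) \<longleftrightarrow> (\<forall>i<m_y I. block (n_u I) u i \<in> U_set c I)"
proof -
  let ?n = "n_u I" and ?r = "dim_row (B_mat I)" and ?m = "m_y I"
  let ?P = "\<lambda>i k. (map_mat real_of_rat (B_mat I) *\<^sub>v block ?n u i) $ k \<le> real_of_rat (b_vec I $ k)"
  have "map_mat real_of_rat (B_mat (split_rows I)) *\<^sub>v u \<le> map_vec real_of_rat (b_vec (split_rows I)) \<longleftrightarrow>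
      (\<forall>l<?m * ?r. (map_mat real_of_rat (B_mat (split_rows I)) *\<^sub>v u) $ l \<le> real_of_rat (b_vec I $ (l mod ?r)))"
    by (simp add: less_eq_vec_def) (auto simp: split_rows_def Let_def)
  also have "\<dots> \<longleftrightarrow> (\<forall>i<?m. \<forall>k<?r. ?P i k)"
  proof (intro iffI allI impI)
    fix l assume *: "\<forall>i<?m. \<forall>k<?r. ?P i k" and l: "l < ?m * ?r"
    note d = div_mod_less[OF l]
    show "(map_mat real_of_rat (B_mat (split_rows I)) *\<^sub>v u) $ l \<le> real_of_rat (b_vec I $ (l mod ?r))"
      using mult_B_split_rows[OF d, of u] * d u by (simp add: div_mult_mod_eq)
  next
    fix i k assume *: "\<forall>l<?m * ?r. (map_mat real_of_rat (B_mat (split_rows I)) *\<^sub>v u) $ l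
        \<le> real_of_rat (b_vec I $ (l mod ?r))" and ik: "i < ?m" "k < ?r"
    have "(i * ?r + k) mod ?r = k" using ik by simp
    then show "?P i k"
      using *[rule_format, OF block_index_less[OF ik]] mult_B_split_rows[OF ik, of u] u by simp
  qed
  also have "\<dots> \<longleftrightarrow> (\<forall>i<?m. map_mat real_of_rat (B_mat I) *\<^sub>v block ?n u i \<le> map_vec real_of_rat (b_vec I))"
    using assms(1) by (auto simp: less_eq_vec_def wf_instance_def)
  finally show ?thesis
    using box_points_blocks[OF u] by (auto simp: U_set_def)
qed

text \<open>Coefficient matrices that belong to other copies have a zero row \<open>i\<close>, so
  the sum over all coordinates collapses to block \<open>i\<close>.\<close>

lemma T_of_split_rows:
  assumes "i < m_y I" "j < n_x I"
  shows "T_of (split_rows I) u $$ (i, j) = T_of I (block (n_u I) u i) $$ (i, j)"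
proof -
  let ?n = "n_u I" and ?m = "m_y I"
  have "T_of (split_rows I) u $$ (i, j) =
      (\<Sum>l<?m * ?n. u $ l * real_of_rat (T_mats (split_rows I) ! l $$ (i, j)))"
    using assms by (simp add: T_of_def)
  also have "\<dots> = (\<Sum>l<?m * ?n. if i = l div ?n then u $ l * real_of_rat (T_mats I ! (l mod ?n) $$ (i, j)) else 0)"
    using assms by (intro sum.cong) (auto simp: split_rows_def Let_def)
  also have "\<dots> = (\<Sum>p<?m. \<Sum>q<?n. if i = p then u $ (p * ?n + q) * real_of_rat (T_mats I ! q $$ (i, j)) else 0)"
    by (subst sum_blocks, intro sum.cong) auto
  also have "\<dots> = (\<Sum>p<?m. if i = p then \<Sum>q<?n. u $ (p * ?n + q) * real_of_rat (T_mats I ! q $$ (i, j)) else 0)"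
    by (intro sum.cong) auto
  also have "\<dots> = (\<Sum>q<?n. u $ (i * ?n + q) * real_of_rat (T_mats I ! q $$ (i, j)))"
    using assms(1) by simp
  also have "\<dots> = T_of I (block ?n u i) $$ (i, j)"
    using assms by (simp add: T_of_def block_def)
  finally show ?thesis .
qed

lemma Y_set_iff:
  "y \<in> Y_set c I x u \<longleftrightarrow> y \<in> box_points c (R_bound I) (n_y I) \<and>
     (\<forall>i<m_y I. (T_of I u *\<^sub>v x) $ i + (map_mat real_of_rat (W_mat I) *\<^sub>v y) $ i \<le> 0)"
  by (auto simp: Y_set_def less_eq_vec_def m_y_def)

lemma Y_set_split_rows_iff:
  assumes "x \<in> carrier_vec (n_x I)"
  shows "y \<in> Y_set c (split_rows I) x u \<longleftrightarrow> y \<in> box_points c (R_bound I) (n_y I) \<and>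
     (\<forall>i<m_y I. (T_of I (block (n_u I) u i) *\<^sub>v x) $ i + (map_mat real_of_rat (W_mat I) *\<^sub>v y) $ i \<le> 0)"
proof -
  have "(T_of (split_rows I) u *\<^sub>v x) $ i = (T_of I (block (n_u I) u i) *\<^sub>v x) $ i" if "i < m_y I" for i
  proof -
    have d: "dim_row (T_of J v) = m_y J" "dim_col (T_of J v) = n_x J" for J v by (simp_all add: T_of_def)
    show ?thesis
      using that assms T_of_split_rows[OF that]
      by (subst (1 2) mult_mat_vec_index) (auto simp: d intro!: sum.cong)
  qed
  then show ?thesis by (auto simp: Y_set_iff)
qed

lemma K_adaptable_split_rowsD:
  assumes wf: "wf_instance I" and "K_adaptable cX cU cY K (split_rows I)" "1 \<le> K"
  shows "K_adaptable cX cU cY 1 I"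
proof -
  let ?n = "n_u I" and ?m = "m_y I"
  obtain x y where x: "x \<in> X_set cX I" and y: "\<forall>k\<in>{1..K}. y k \<in> carrier_vec (n_y I)"
    and rob: "\<forall>u\<in>U_set cU (split_rows I). y ` {1..K} \<inter> Y_set cY (split_rows I) x u \<noteq> {}"
    using assms(2) unfolding K_adaptable_def by (auto simp: X_set_split_rows)
  have xc: "x \<in> carrier_vec (n_x I)" using x by (simp add: X_set_def box_points_def)
  have "\<exists>k\<in>{1..K}. \<forall>u\<in>U_set cU I. y k \<in> Y_set cY I x u"
  proof (rule ccontr)
    assume "\<not> ?thesis"
    \<comment> \<open>One violating scenario for each policy; from here on only these finitely many
      are compared.\<close>
    then obtain w where w: "\<And>k. k \<in> {1..K} \<Longrightarrow> w k \<in> U_set cU I \<and> y k \<notin> Y_set cY I x (w k)"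
      by metis
    let ?g = "\<lambda>i k. (T_of I (w k) *\<^sub>v x) $ i"
    \<comment> \<open>The maximum exists for every \<open>i\<close>, even outside the rows, where
      the entry is unspecified: it suffices that \<open>{1..K}\<close> is finite and
      nonempty.\<close>
    have "\<exists>k\<in>{1..K}. \<forall>k'\<in>{1..K}. ?g i k' \<le> ?g i k" for i
    proof -
      have "Max (?g i ` {1..K}) \<in> ?g i ` {1..K}" using \<open>1 \<le> K\<close> by (intro Max_in) auto
      then obtain k where "k \<in> {1..K}" "?g i k = Max (?g i ` {1..K})" by auto
      then show ?thesis by (intro bexI[of _ k]) auto
    qed
    then obtain \<kappa> where \<kappa>: "\<And>i. \<kappa> i \<in> {1..K}" "\<And>i k. k \<in> {1..K} \<Longrightarrow> ?g i k \<le> ?g i (\<kappa> i)"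
      by metis
    define u where "u = vec (?m * ?n) (\<lambda>l. w (\<kappa> (l div ?n)) $ (l mod ?n))"
    have wdim: "dim_vec (w (\<kappa> i)) = ?n" for i
      using w[OF \<kappa>(1)[of i]] by (auto simp: U_set_def box_points_def)
    have block: "block ?n u i = w (\<kappa> i)" if "i < ?m" for i
    proof (rule eq_vecI)
      fix k assume "k < dim_vec (w (\<kappa> i))"
      then have k: "k < ?n" by (simp add: wdim)
      have "(i * ?n + k) div ?n = i" "(i * ?n + k) mod ?n = k" using k by simp_all
      then show "block ?n u i $ k = w (\<kappa> i) $ k"
        using k block_index_less[OF that k] by (simp add: block_def u_def)
    qed (simp add: wdim)
    have "u \<in> U_set cU (split_rows I)"
      using w[OF \<kappa>(1)] by (subst U_set_split_rows[OF wf]) (simp_all add: u_def[symmetric] block, simp add: u_def)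
    then obtain k where k: "k \<in> {1..K}" "y k \<in> Y_set cY (split_rows I) x u" using rob by blast
    \<comment> \<open>By \<open>k(2)\<close> the policy \<open>y k\<close> lies in the box, so its
      failure at \<open>w k\<close> must come from a violated row. In that row the scenario of block
      \<open>i\<close> is at least as bad, yet \<open>y k\<close> satisfies the row there.\<close>
    then obtain i where i: "i < ?m" "0 < ?g i k + (map_mat real_of_rat (W_mat I) *\<^sub>v y k) $ i"
      using w[OF k(1)] unfolding Y_set_split_rows_iff[OF xc] by (auto simp: Y_set_iff not_le)
    moreover have "?g i (\<kappa> i) + (map_mat real_of_rat (W_mat I) *\<^sub>v y k) $ i \<le> 0"
      using k(2) i(1) block[OF i(1)] unfolding Y_set_split_rows_iff[OF xc] by auto
    ultimately show False using \<kappa>(2)[OF k(1), of i] by linarith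
  qed
  then obtain k where "k \<in> {1..K}" "\<forall>u\<in>U_set cU I. y k \<in> Y_set cY I x u" by blast
  then show ?thesis
    unfolding K_adaptable_def using x y by (intro bexI[of _ x] exI[of _ "\<lambda>_. y k"]) auto
qed

text \<open>A single policy is repeated \<open>K\<close> times: each new constraint is an old one
  evaluated at a block, and every block is an old scenario.\<close>

lemma K_adaptable_split_rowsI:
  assumes wf: "wf_instance I" and "K_adaptable cX cU cY 1 I" "1 \<le> K"
  shows "K_adaptable cX cU cY K (split_rows I)"
proof -
  obtain x y where x: "x \<in> X_set cX I" and y: "y 1 \<in> carrier_vec (n_y I)"
    and rob: "\<forall>u\<in>U_set cU I. y 1 \<in> Y_set cY I x u"
    using assms(2) unfolding K_adaptable_def by auto
  have xc: "x \<in> carrier_vec (n_x I)" using x by (simp add: X_set_def box_points_def)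
  \<comment> \<open>Without rows the new uncertainty set is a singleton even if the old one is empty, and then \<open>y 1\<close> may
    lie outside the box.\<close>
  define z where "z = (if m_y I = 0 then 0\<^sub>v (n_y I) else y 1)"
  have "z \<in> Y_set cY (split_rows I) x u" if u: "u \<in> U_set cU (split_rows I)" for u
  proof (cases "m_y I = 0")
    case True
    then show ?thesis by (simp add: Y_set_split_rows_iff[OF xc] z_def box_points_def)
  next
    case False
    have "u \<in> carrier_vec (m_y I * n_u I)" using u by (simp add: U_set_def box_points_def)
    then have "\<forall>i<m_y I. y 1 \<in> Y_set cY I x (block (n_u I) u i)"
      using u rob U_set_split_rows[OF wf] by blast
    then show ?thesis using False unfolding Y_set_split_rows_iff[OF xc] by (auto simp: Y_set_iff z_def)
  qed
  moreover have "(\<lambda>_. z) ` {1..K} = {z}" using \<open>1 \<le> K\<close> by auto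
  moreover have "z \<in> carrier_vec (n_y I)" using y by (simp add: z_def)
  ultimately show ?thesis
    unfolding K_adaptable_def using x
    by (intro bexI[of _ x] exI[of _ "\<lambda>_. z"]) (simp_all add: X_set_split_rows)
qed

section \<open>The program\<close>

lemma less_tape_num [simp]: "i < 15 \<Longrightarrow> i < tape_num"
  by (simp add: tape_num_def)

lemma zero_notin_token: "is_token x \<Longrightarrow> 0 \<notin> set x"
  by (auto simp: is_token_def)

lemma is_tokenE:
  assumes "is_token x"
  obtains w where "x = w @ [Sym_end]" "Sym_end \<notin> set w"
  using assms unfolding is_token_def by (metis greaterThanLessThan_iff less_irrefl subsetD)

lemma transfers_token:
  assumes "i < tape_num" "j < tape_num" "i \<noteq> j" "is_token x" "length x \<le> N"
  shows "transfers (copy_token_tm i j) s i j x x (3 * N + 3)"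
proof -
  obtain w where "x = w @ [Sym_end]" "Sym_end \<notin> set w" using assms(4) by (rule is_tokenE)
  then show ?thesis using transfers_copy_token[OF assms(1-3)] assms(5) by simp
qed

lemma transfers_skip:
  assumes "i < tape_num" "i \<noteq> j" "is_token x" "length x \<le> N"
  shows "transfers (skip_token_tm i) s i j x [] (2 * N + 2)"
proof -
  obtain w where "x = w @ [Sym_end]" "Sym_end \<notin> set w" using assms(3) by (rule is_tokenE)
  then show ?thesis using transfers_skip_token[OF assms(1,2)] assms(4) by simp
qed

lemma is_token_encode_dim: "is_token (encode_dim n)"
  by (auto simp: encode_dim_def is_token_def)

lemma transfers_tokens:
  assumes "c < tape_num" "i < tape_num" "j < tape_num" "i \<noteq> j" "c \<noteq> i" "c \<noteq> j"
    and "s c = ([0], w)" "0 \<notin> set w" "length w = n" "n \<le> N"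
    and "\<And>k. k < n \<Longrightarrow> is_token (x k)" "\<And>k. k < n \<Longrightarrow> length (x k) \<le> N"
  shows "transfers (for_tm c (copy_token_tm i j)) s i j (cat n x) (cat n x) (loop_time N (3 * N + 3))"
  by (rule transfers_for[where w = w]) (use assms in \<open>auto intro!: transfers_token\<close>)

lemma transfers_grid:
  assumes "c < tape_num" "d < tape_num" "i < tape_num" "j < tape_num" "i \<noteq> j" "c \<noteq> i" "c \<noteq> j"
      "d \<noteq> i" "d \<noteq> j" "c \<noteq> d"
    and "s c = ([0], w)" "0 \<notin> set w" "length w = m" "m \<le> N"
    and "s d = ([0], w')" "0 \<notin> set w'" "length w' = n" "n \<le> N"
    and "\<And>k l. k < m \<Longrightarrow> l < n \<Longrightarrow> is_token (x k l)" "\<And>k l. k < m \<Longrightarrow> l < n \<Longrightarrow> length (x k l) \<le> N"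
  shows "transfers (for_tm c (for_tm d (copy_token_tm i j))) s i j
    (cat m (\<lambda>k. cat n (x k))) (cat m (\<lambda>k. cat n (x k))) (loop_time N (loop_time N (3 * N + 3)))"
proof (rule transfers_for[where w = w])
  show "transfers (for_tm d (copy_token_tm i j)) (s(c := at_pos w k)) i j (cat n (x k)) (cat n (x k))
      (loop_time N (3 * N + 3))" if "k < m" for k
    by (rule transfers_tokens[where w = w']) (use assms that in simp_all)
qed (use assms in simp_all)

definition dim_tm :: "nat \<Rightarrow> nat \<Rightarrow> turing_machine" where
  "dim_tm c j = for_tm c (put_tm j Sym_1) ;; put_tm j Sym_end"

definition dim_mult_tm :: "nat \<Rightarrow> nat \<Rightarrow> nat \<Rightarrow> turing_machine" where
  "dim_mult_tm c d j = for_tm c (for_tm d (put_tm j Sym_1)) ;; put_tm j Sym_end"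

definition zero_tm :: "nat \<Rightarrow> turing_machine" where
  "zero_tm j = put_tm j Sym_0 ;; put_tm j Sym_slash ;; put_tm j Sym_1 ;; put_tm j Sym_end"

lemma is_program_dim [simp]:
  "c < tape_num \<Longrightarrow> is_program (dim_tm c j)"
  "c < tape_num \<Longrightarrow> d < tape_num \<Longrightarrow> is_program (dim_mult_tm c d j)"
  "is_program (zero_tm j)"
  by (simp_all add: dim_tm_def dim_mult_tm_def zero_tm_def)

text \<open>Only the length of the counter word matters, so a dimension can be written even while
  its counter carries a mark, as happens for T.\<close>

lemma transfers_dim:
  assumes "c < tape_num" "j < tape_num" "c \<noteq> i" "c \<noteq> j"
    and "s c = ([0], w)" "0 \<notin> set w" "length w = n" "n \<le> N"
  shows "transfers (dim_tm c j) s i j [] (encode_dim n) (loop_time N 1 + 1)"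
proof -
  have 1: "transfers (for_tm c (put_tm j Sym_1)) s i j (cat n (\<lambda>_. [])) (cat n (\<lambda>_. [Sym_1])) (loop_time N 1)"
    by (rule transfers_for[where w = w]) (use assms in \<open>simp_all add: transfers_put del: One_nat_def\<close>)
  show ?thesis
    unfolding dim_tm_def
    by (rule transfers_cong[OF transfers_seq[OF _ _ 1 transfers_put]])
       (use assms in \<open>simp_all add: encode_dim_def cat_replicate[where n = 1, simplified]\<close>)
qed

lemma transfers_dim_mult:
  assumes "c < tape_num" "d < tape_num" "j < tape_num" "c \<noteq> i" "c \<noteq> j" "d \<noteq> i" "d \<noteq> j" "c \<noteq> d"
    and "s c = ([0], w)" "0 \<notin> set w" "length w = m" "m \<le> N"
    and "s d = ([0], w')" "0 \<notin> set w'" "length w' = n" "n \<le> N"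
  shows "transfers (dim_mult_tm c d j) s i j [] (encode_dim (m * n)) (loop_time N (loop_time N 1) + 1)"
proof -
  have 1: "transfers (for_tm d (put_tm j Sym_1)) (s(c := z)) i j (cat n (\<lambda>_. [])) (cat n (\<lambda>_. [Sym_1])) (loop_time N 1)" for z
    by (rule transfers_for[where w = w']) (use assms in \<open>simp_all add: transfers_put del: One_nat_def\<close>)
  have 2: "transfers (for_tm c (for_tm d (put_tm j Sym_1))) s i j (cat m (\<lambda>_. cat n (\<lambda>_. []))) (cat m (\<lambda>_. cat n (\<lambda>_. [Sym_1])))
      (loop_time N (loop_time N 1))"
    by (rule transfers_for[where w = w, OF _ _ _ _ _ _ _ _ 1]) (use assms in simp_all)
  show ?thesis
    unfolding dim_mult_tm_def
    by (rule transfers_cong[OF transfers_seq[OF _ _ 2 transfers_put]])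
       (use assms in \<open>simp_all add: encode_dim_def cat_replicate cat_replicate[where n = 1, simplified]\<close>)
qed

lemma transfers_zero: "j < tape_num \<Longrightarrow> transfers (zero_tm j) s i j [] (encode_rat 0) 4"
  unfolding zero_tm_def
  by (rule transfers_cong[OF transfers_seq[OF _ _ transfers_put transfers_seq[OF _ _ transfers_put
        transfers_seq[OF _ _ transfers_put transfers_put]]]])
     (simp_all add: encode_rat_0)

text \<open>Tape 0 is the input and tape 1 the output. The dimensions \<open>rA, cA, rB, cB, rW, cW\<close> of \<open>A\<close>, \<open>B\<close> and \<open>W\<close> are stored
  on tapes 3, 4, 7, 8, 11 and 12, the bound \<open>R\<close> on tape 2, and the entries of \<open>A, a, B, b, W, T\<close>, without
  dimensions, on tapes 5, 6, 9, 10, 13 and 14.\<close>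

definition load_program :: turing_machine where
  "load_program =
     load_tm 2 (copy_token_tm 0 2) ;;
     load_tm 3 (copy_word_tm 0 3) ;;
     load_tm 4 (copy_word_tm 0 4) ;;
     load_tm 5 (for_tm 3 (for_tm 4 (copy_token_tm 0 5))) ;;
     load_tm 6 (skip_token_tm 0 ;; for_tm 3 (copy_token_tm 0 6)) ;;
     load_tm 7 (copy_word_tm 0 7) ;;
     load_tm 8 (copy_word_tm 0 8) ;;
     load_tm 9 (for_tm 7 (for_tm 8 (copy_token_tm 0 9))) ;;
     load_tm 10 (skip_token_tm 0 ;; for_tm 7 (copy_token_tm 0 10)) ;;
     load_tm 11 (copy_word_tm 0 11) ;;
     load_tm 12 (copy_word_tm 0 12) ;;
     load_tm 13 (for_tm 11 (for_tm 12 (copy_token_tm 0 13))) ;;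
     load_tm 14 (skip_token_tm 0 ;;
       for_tm 8 (skip_token_tm 0 ;; skip_token_tm 0 ;; for_tm 11 (for_tm 4 (copy_token_tm 0 14))))"

definition write_program :: turing_machine where
  "write_program =
     from_tm 2 (copy_token_tm 2 1) ;;
     dim_tm 3 1 ;; dim_tm 4 1 ;; from_tm 5 (for_tm 3 (for_tm 4 (copy_token_tm 5 1))) ;;
     dim_tm 3 1 ;; from_tm 6 (for_tm 3 (copy_token_tm 6 1)) ;;
     dim_mult_tm 11 7 1 ;; dim_mult_tm 11 8 1 ;;
     mark_each_tm 11 (from_tm 9
       (for_tm 7 (for_tm 11 (for_tm 8 (if_tm 11 Sym_0 (copy_token_tm 9 1) (zero_tm 1)))))) ;;
     dim_mult_tm 11 7 1 ;; for_tm 11 (from_tm 10 (for_tm 7 (copy_token_tm 10 1))) ;;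
     dim_tm 11 1 ;; dim_tm 12 1 ;; from_tm 13 (for_tm 11 (for_tm 12 (copy_token_tm 13 1))) ;;
     dim_mult_tm 11 8 1 ;;
     mark_each_tm 11 (from_tm 14 (for_tm 8 (dim_tm 11 1 ;; dim_tm 4 1 ;;
       for_tm 11 (for_tm 4 (if_tm 11 Sym_0 (copy_token_tm 14 1) (skip_token_tm 14 ;; zero_tm 1))))))"

lemma is_program_load_program [simp]: "is_program load_program"
  by (simp add: load_program_def)

lemma is_program_write_program [simp]: "is_program write_program"
  by (simp add: write_program_def)

section \<open>Layout of the input and the loading phase\<close>

abbreviation (input) "grid m n x \<equiv> cat m (\<lambda>i. cat n (x i))"

text \<open>All that the machine depends on: dimensions in unary and opaque tokens in a fixed order.
  Well-formedness enters through the repeated dimensions, such as \<open>rA\<close> for A and for a;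
  they agree, so later occurrences can be skipped.\<close>

locale input_tokens =
  fixes N :: nat and xR :: "nat list" and rA cA rB cB rW cW :: nat
    and xA xB xW :: "nat \<Rightarrow> nat \<Rightarrow> nat list" and xa xb :: "nat \<Rightarrow> nat list"
    and xT :: "nat \<Rightarrow> nat \<Rightarrow> nat \<Rightarrow> nat list" and input :: "nat list"
  assumes tokens: "is_token xR" "\<And>i j. is_token (xA i j)" "\<And>i. is_token (xa i)" "\<And>i j. is_token (xB i j)"
      "\<And>i. is_token (xb i)" "\<And>i j. is_token (xW i j)" "\<And>k i j. is_token (xT k i j)"
    and input_def: "input = xR @ encode_dim rA @ encode_dim cA @ grid rA cA xA @ encode_dim rA @ cat rA xa @
      encode_dim rB @ encode_dim cB @ grid rB cB xB @ encode_dim rB @ cat rB xb @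
      encode_dim rW @ encode_dim cW @ grid rW cW xW @
      encode_dim cB @ cat cB (\<lambda>k. encode_dim rW @ encode_dim cA @ grid rW cA (xT k))"
    and length_input: "length input \<le> N"
begin

definition contents :: "nat \<Rightarrow> nat list" where
  "contents = (\<lambda>_. [])(2 := xR, 3 := replicate rA Sym_1, 4 := replicate cA Sym_1, 5 := grid rA cA xA,
    6 := cat rA xa, 7 := replicate rB Sym_1, 8 := replicate cB Sym_1, 9 := grid rB cB xB, 10 := cat rB xb,
    11 := replicate rW Sym_1, 12 := replicate cW Sym_1, 13 := grid rW cW xW,
    14 := cat cB (\<lambda>k. grid rW cA (xT k)))"

lemma length_encode_dim: "length (encode_dim n) = n + 1"
  by (simp add: encode_dim_def)

lemma lengths:
  "length xR \<le> N" "rA < N" "cA < N" "rB < N" "cB < N" "rW < N" "cW < N"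
  "length (grid rA cA xA) \<le> N" "length (cat rA xa) \<le> N" "length (grid rB cB xB) \<le> N"
  "length (cat rB xb) \<le> N" "length (grid rW cW xW) \<le> N"
  "length (cat cB (\<lambda>k. encode_dim rW @ encode_dim cA @ grid rW cA (xT k))) \<le> N"
  using length_input unfolding input_def length_append length_encode_dim by linarith+

lemma length_T: "length (cat cB (\<lambda>k. grid rW cA (xT k))) \<le> N"
proof -
  have "length (cat cB (\<lambda>k. grid rW cA (xT k))) \<le>
      length (cat cB (\<lambda>k. encode_dim rW @ encode_dim cA @ grid rW cA (xT k)))"
    by (simp add: length_concat o_def sum_list_mono)
  then show ?thesis using lengths by linarith
qed

lemma length_grid: "i < m \<Longrightarrow> j < n \<Longrightarrow> length (x i j) \<le> length (grid m n x)"
  using length_cat[of i m "\<lambda>i. cat n (x i)"] length_cat[of j n "x i"] by linarith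

lemma entry_lengths:
  "i < rA \<Longrightarrow> j < cA \<Longrightarrow> length (xA i j) \<le> N" "i < rA \<Longrightarrow> length (xa i) \<le> N"
  "i < rB \<Longrightarrow> j < cB \<Longrightarrow> length (xB i j) \<le> N" "i < rB \<Longrightarrow> length (xb i) \<le> N"
  "i < rW \<Longrightarrow> j < cW \<Longrightarrow> length (xW i j) \<le> N"
  "k < cB \<Longrightarrow> i < rW \<Longrightarrow> j < cA \<Longrightarrow> length (xT k i j) \<le> N"
  using lengths length_T length_grid[of i rA j cA xA] length_cat[of i rA xa] length_grid[of i rB j cB xB]
    length_cat[of i rB xb] length_grid[of i rW j cW xW] length_grid[of i rW j cA "xT k"]
    length_cat[of k cB "\<lambda>k. grid rW cA (xT k)"]
  by linarith+

text \<open>The situation right before tape \<open>k\<close> is filled: in \<open>store 2\<close>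
  all tapes are empty, in \<open>store 15\<close> all work tapes are filled.\<close>

definition store :: "nat \<Rightarrow> store" where
  "store k i = (if 2 \<le> i \<and> i < k then ([0], contents i) else ([], []))"

lemma zero_notin_contents: "0 \<notin> set (contents i)"
proof -
  have "0 \<notin> set xR" "\<And>i j. 0 \<notin> set (xA i j)" "\<And>i. 0 \<notin> set (xa i)" "\<And>i j. 0 \<notin> set (xB i j)"
    "\<And>i. 0 \<notin> set (xb i)" "\<And>i j. 0 \<notin> set (xW i j)" "\<And>k i j. 0 \<notin> set (xT k i j)"
    using tokens zero_notin_token by blast+
  then show ?thesis by (simp add: contents_def)
qed

lemma length_contents: "length (contents i) \<le> N"
  using lengths length_T by (simp add: contents_def)

lemma loads_step:
  assumes "is_program M" "2 \<le> j" "j < tape_num" "k = Suc j"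
    and "transfers M (store j) 0 j u (contents j) t"
  shows "loads (load_tm j M) (store j) u (store k) (t + 2 * N + 4)"
proof -
  have "store k = (store j)(j := ([0], contents j))"
    using assms(2,4) by (auto simp: store_def fun_eq_iff)
  then show ?thesis
    using loads_load[of M j "store j" "contents j" N u t] assms zero_notin_contents length_contents
    by (simp add: store_def)
qed

lemma store_simps:
  "2 \<le> i \<Longrightarrow> i < k \<Longrightarrow> store k i = ([0], contents i)"
  by (simp add: store_def)

lemma loads_dim:
  assumes "2 \<le> j" "j < tape_num" "k = Suc j" "contents j = replicate n Sym_1" "n \<le> N"
  shows "loads (load_tm j (copy_word_tm 0 j)) (store j) (encode_dim n) (store k) (3 * N + 2 + 2 * N + 4)"
proof (rule loads_step)
  have "transfers (copy_word_tm 0 j) (store j) 0 j (replicate n Sym_1 @ [Sym_end]) (replicate n Sym_1) (3 * N + 2)"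
    by (rule transfers_copy_word) (use assms in simp_all)
  then show "transfers (copy_word_tm 0 j) (store j) 0 j (encode_dim n) (contents j) (3 * N + 2)"
    by (simp add: assms(4) encode_dim_def)
qed (use assms in simp_all)

lemma loads_tokens:
  assumes "2 \<le> c" "c < j" "j < tape_num" "k = Suc j" "contents c = replicate n Sym_1" "n < N"
    and "contents j = cat n x" "\<And>i. is_token (x i)" "\<And>i. i < n \<Longrightarrow> length (x i) \<le> N"
  shows "loads (load_tm j (skip_token_tm 0 ;; for_tm c (copy_token_tm 0 j))) (store j)
    (encode_dim n @ cat n x) (store k) (2 * N + 2 + loop_time N (3 * N + 3) + 2 * N + 4)"
proof (rule loads_step)
  have 1: "transfers (skip_token_tm 0) (store j) 0 j (encode_dim n) [] (2 * N + 2)"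
    by (rule transfers_skip) (use assms in \<open>simp_all add: is_token_encode_dim length_encode_dim\<close>)
  have 2: "transfers (for_tm c (copy_token_tm 0 j)) (store j) 0 j (cat n x) (cat n x) (loop_time N (3 * N + 3))"
    by (rule transfers_tokens[where w = "replicate n Sym_1"]) (use assms in \<open>simp_all add: store_simps\<close>)
  show "transfers (skip_token_tm 0 ;; for_tm c (copy_token_tm 0 j)) (store j) 0 j (encode_dim n @ cat n x)
      (contents j) (2 * N + 2 + loop_time N (3 * N + 3))"
    using transfers_seq[OF _ _ 1 2] assms by simp
qed (use assms in simp_all)

lemma loads_grid:
  assumes "2 \<le> c" "c < j" "2 \<le> d" "d < j" "c \<noteq> d" "j < tape_num" "k = Suc j"
    and "contents c = replicate m Sym_1" "m < N" "contents d = replicate n Sym_1" "n < N"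
    and "contents j = grid m n x" "\<And>i l. is_token (x i l)" "\<And>i l. i < m \<Longrightarrow> l < n \<Longrightarrow> length (x i l) \<le> N"
  shows "loads (load_tm j (for_tm c (for_tm d (copy_token_tm 0 j)))) (store j)
    (grid m n x) (store k) (loop_time N (loop_time N (3 * N + 3)) + 2 * N + 4)"
proof (rule loads_step)
  have "transfers (for_tm c (for_tm d (copy_token_tm 0 j))) (store j) 0 j (grid m n x) (grid m n x)
      (loop_time N (loop_time N (3 * N + 3)))"
    by (rule transfers_grid[where w = "replicate m Sym_1" and w' = "replicate n Sym_1"])
       (use assms in \<open>simp_all add: store_simps\<close>)
  then show "transfers (for_tm c (for_tm d (copy_token_tm 0 j))) (store j) 0 j (grid m n x) (contents j)
      (loop_time N (loop_time N (3 * N + 3)))"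
    using assms by simp
qed (use assms in simp_all)

lemma loads_T:
  "loads (load_tm 14 (skip_token_tm 0 ;;
       for_tm 8 (skip_token_tm 0 ;; skip_token_tm 0 ;; for_tm 11 (for_tm 4 (copy_token_tm 0 14)))))
     (store 14) (encode_dim cB @ cat cB (\<lambda>k. encode_dim rW @ encode_dim cA @ grid rW cA (xT k))) (store 15)
     (2 * N + 2 + loop_time N (2 * N + 2 + (2 * N + 2 + loop_time N (loop_time N (3 * N + 3)))) + 2 * N + 4)"
proof (rule loads_step)
  have skip: "transfers (skip_token_tm 0) s 0 14 (encode_dim n) [] (2 * N + 2)" if "n < N" for s n
    by (rule transfers_skip) (use that in \<open>simp_all add: is_token_encode_dim length_encode_dim\<close>)
  have body: "transfers (skip_token_tm 0 ;; skip_token_tm 0 ;; for_tm 11 (for_tm 4 (copy_token_tm 0 14)))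
      ((store 14)(8 := at_pos (replicate cB Sym_1) k)) 0 14
      (encode_dim rW @ encode_dim cA @ grid rW cA (xT k)) (grid rW cA (xT k))
      (2 * N + 2 + (2 * N + 2 + loop_time N (loop_time N (3 * N + 3))))" if "k < cB" for k
  proof -
    let ?s = "(store 14)(8 := at_pos (replicate cB Sym_1) k)"
    have grid: "transfers (for_tm 11 (for_tm 4 (copy_token_tm 0 14))) ?s 0 14 (grid rW cA (xT k)) (grid rW cA (xT k))
        (loop_time N (loop_time N (3 * N + 3)))"
      by (rule transfers_grid[where w = "replicate rW Sym_1" and w' = "replicate cA Sym_1"])
         (use lengths tokens entry_lengths that in \<open>simp_all add: store_simps contents_def\<close>)
    show ?thesis
      using transfers_seq[OF _ _ skip[OF lengths(6)] transfers_seq[OF _ _ skip[OF lengths(3)] grid]] by simp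
  qed
  have "transfers (for_tm 8 (skip_token_tm 0 ;; skip_token_tm 0 ;; for_tm 11 (for_tm 4 (copy_token_tm 0 14))))
      (store 14) 0 14 (cat cB (\<lambda>k. encode_dim rW @ encode_dim cA @ grid rW cA (xT k)))
      (cat cB (\<lambda>k. grid rW cA (xT k)))
      (loop_time N (2 * N + 2 + (2 * N + 2 + loop_time N (loop_time N (3 * N + 3)))))"
    by (rule transfers_for[where w = "replicate cB Sym_1", OF _ _ _ _ _ _ _ _ body])
       (use lengths in \<open>simp_all add: store_simps contents_def\<close>)
  from transfers_seq[OF _ _ skip this, of cB] show
    "transfers (skip_token_tm 0 ;;
       for_tm 8 (skip_token_tm 0 ;; skip_token_tm 0 ;; for_tm 11 (for_tm 4 (copy_token_tm 0 14))))
      (store 14) 0 14 (encode_dim cB @ cat cB (\<lambda>k. encode_dim rW @ encode_dim cA @ grid rW cA (xT k)))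
      (contents 14)
      (2 * N + 2 + loop_time N (2 * N + 2 + (2 * N + 2 + loop_time N (loop_time N (3 * N + 3)))))"
    using lengths by (simp add: contents_def)
qed simp_all

end

text \<open>The bracketing follows the right-associative \<open>;;\<close>, so that the sums of
  times produced by \<open>loads_seq\<close> unify with it; the time bound of the writing phase is
  bracketed likewise.\<close>

definition load_time :: "nat \<Rightarrow> nat" where
  "load_time N =
     (let dim = 3 * N + 2 + 2 * N + 4;
          tok = 2 * N + 2 + loop_time N (3 * N + 3) + 2 * N + 4;
          grd = loop_time N (loop_time N (3 * N + 3)) + 2 * N + 4
      in (3 * N + 3 + 2 * N + 4) + (dim + (dim + (grd + (tok + (dim + (dim + (grd + (tok + (dim + (dim + (grd +
        (2 * N + 2 + loop_time N (2 * N + 2 + (2 * N + 2 + loop_time N (loop_time N (3 * N + 3)))) + 2 * N + 4)))))))))))))"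

context input_tokens
begin

lemma loads_load_program: "loads load_program (store 2) input (store 15) (load_time N)"
proof -
  have R: "loads (load_tm 2 (copy_token_tm 0 2)) (store 2) xR (store 3) (3 * N + 3 + 2 * N + 4)"
    by (rule loads_step)
       (use transfers_token[of 0 2 xR N] tokens lengths in \<open>simp_all add: contents_def\<close>)
  have dim: "contents 3 = replicate rA Sym_1" "contents 4 = replicate cA Sym_1" "contents 7 = replicate rB Sym_1"
    "contents 8 = replicate cB Sym_1" "contents 11 = replicate rW Sym_1" "contents 12 = replicate cW Sym_1"
    by (simp_all add: contents_def)
  have le: "rA \<le> N" "cA \<le> N" "rB \<le> N" "cB \<le> N" "rW \<le> N" "cW \<le> N" using lengths by simp_all
  have grid: "contents 5 = grid rA cA xA" "contents 9 = grid rB cB xB" "contents 13 = grid rW cW xW"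
    and toks: "contents 6 = cat rA xa" "contents 10 = cat rB xb"
    by (simp_all add: contents_def)
  note d = loads_dim[OF _ _ _ dim(1) le(1)] loads_dim[OF _ _ _ dim(2) le(2)] loads_dim[OF _ _ _ dim(3) le(3)]
    loads_dim[OF _ _ _ dim(4) le(4)] loads_dim[OF _ _ _ dim(5) le(5)] loads_dim[OF _ _ _ dim(6) le(6)]
  note t = loads_tokens[OF _ _ _ _ dim(1) lengths(2) toks(1) tokens(3) entry_lengths(2)]
    loads_tokens[OF _ _ _ _ dim(3) lengths(4) toks(2) tokens(5) entry_lengths(4)]
  note g = loads_grid[OF _ _ _ _ _ _ _ dim(1) lengths(2) dim(2) lengths(3) grid(1) tokens(2) entry_lengths(1)]
    loads_grid[OF _ _ _ _ _ _ _ dim(3) lengths(4) dim(4) lengths(5) grid(2) tokens(4) entry_lengths(3)]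
    loads_grid[OF _ _ _ _ _ _ _ dim(5) lengths(6) dim(6) lengths(7) grid(3) tokens(6) entry_lengths(5)]
  have "loads load_program (store 2)
     (xR @ encode_dim rA @ encode_dim cA @ grid rA cA xA @ (encode_dim rA @ cat rA xa) @
      encode_dim rB @ encode_dim cB @ grid rB cB xB @ (encode_dim rB @ cat rB xb) @
      encode_dim rW @ encode_dim cW @ grid rW cW xW @
      encode_dim cB @ cat cB (\<lambda>k. encode_dim rW @ encode_dim cA @ grid rW cA (xT k)))
     (store 15) (load_time N)"
    unfolding load_program_def load_time_def Let_def
    by (intro loads_seq[OF _ _ R] loads_seq[OF _ _ d(1)[where k = 4]] loads_seq[OF _ _ d(2)[where k = 5]]
        loads_seq[OF _ _ g(1)[where k = 6]] loads_seq[OF _ _ t(1)[where k = 7]]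
        loads_seq[OF _ _ d(3)[where k = 8]] loads_seq[OF _ _ d(4)[where k = 9]]
        loads_seq[OF _ _ g(2)[where k = 10]] loads_seq[OF _ _ t(2)[where k = 11]]
        loads_seq[OF _ _ d(5)[where k = 12]] loads_seq[OF _ _ d(6)[where k = 13]]
        loads_seq[OF _ _ g(3)[where k = 14]] loads_T) simp_all
  then show ?thesis by (simp add: input_def)
qed

end

section \<open>The writing phase\<close>

definition write_time :: "nat \<Rightarrow> nat" where
  "write_time N =
     (let tok = 3 * N + 3; dim = loop_time N 1 + 1; dim2 = loop_time N (loop_time N 1) + 1;
          blk = loop_time N (loop_time N (loop_time N (3 * N + 8)));
          row = loop_time N (dim + (dim + loop_time N (loop_time N (3 * N + 8))))
      in (tok + 2 * N + 3) + (dim + (dim + ((loop_time N (loop_time N tok) + 2 * N + 3) + (dim +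
        ((loop_time N tok + 2 * N + 3) + (dim2 + (dim2 + (mark_time N (blk + 2 * N + 3) + (dim2
        + (loop_time N (loop_time N tok + 2 * N + 3) + (dim + (dim + ((loop_time N (loop_time N tok) + 2 * N
        + 3) + (dim2 + mark_time N (row + 2 * N + 3))))))))))))))))"

context input_tokens
begin

definition result :: "nat list" where
  "result = xR @ encode_dim rA @ encode_dim cA @ grid rA cA xA @ encode_dim rA @ cat rA xa @
     encode_dim (rW * rB) @ encode_dim (rW * cB) @
     cat rW (\<lambda>k. cat rB (\<lambda>i. cat rW (\<lambda>l. cat cB (\<lambda>j. if l = k then xB i j else encode_rat 0)))) @
     encode_dim (rW * rB) @ cat rW (\<lambda>k. cat rB xb) @
     encode_dim rW @ encode_dim cW @ grid rW cW xW @
     encode_dim (rW * cB) @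
     cat rW (\<lambda>k. cat cB (\<lambda>l. encode_dim rW @ encode_dim cA @
       cat rW (\<lambda>i. cat cA (\<lambda>j. if i = k then xT l i j else encode_rat 0))))"

text \<open>Only the diagonal block consumes entries of \<open>B\<close>.\<close>

lemma transfers_B_block:
  assumes s: "s 7 = ([0], replicate rB Sym_1)" "s 8 = ([0], replicate cB Sym_1)" "s 11 = ([0], marked rW k)"
    and k: "k < rW"
  shows "transfers (for_tm 7 (for_tm 11 (for_tm 8 (if_tm 11 Sym_0 (copy_token_tm 9 1) (zero_tm 1))))) s 9 1
    (grid rB cB xB) (cat rB (\<lambda>i. cat rW (\<lambda>l. cat cB (\<lambda>j. if l = k then xB i j else encode_rat 0))))
    (loop_time N (loop_time N (loop_time N (3 * N + 8))))"
proof -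
  have entry: "transfers (if_tm 11 Sym_0 (copy_token_tm 9 1) (zero_tm 1)) s' 9 1
      (if l = k then xB i j else []) (if l = k then xB i j else encode_rat 0) (3 * N + 8)"
    if "s' 11 = at_pos (marked rW k) l" "l < rW" "i < rB" "j < cB" for s' i j l
  \<comment> \<open>\<open>3 * N + 7\<close> bounds both copying a token, \<open>3 * N + 3\<close>,
    and writing a zero, 4; in the T loop it also bounds skipping a token and writing a zero,
    \<open>2 * N + 6\<close>. The test of the mark adds one step.\<close>
  proof (rule transfers_cong[OF transfers_if[where t = "3 * N + 7"]])
    assume "scan (s' 11) = Sym_0"
    then have "l = k" using that k by (simp add: scan_at_pos nth_marked split: if_splits)
    then show "transfers (copy_token_tm 9 1) s' 9 1 (if l = k then xB i j else []) (if l = k then xB i j else encode_rat 0) (3 * N + 7)"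
      using transfers_cong[OF transfers_token[of 9 1 "xB i j" N s'] refl refl, of "3 * N + 7"] tokens entry_lengths that by simp
  next
    assume "scan (s' 11) \<noteq> Sym_0"
    then have "l \<noteq> k" using that k by (simp add: scan_at_pos nth_marked split: if_splits)
    then show "transfers (zero_tm 1) s' 9 1 (if l = k then xB i j else []) (if l = k then xB i j else encode_rat 0) (3 * N + 7)"
      using transfers_cong[OF transfers_zero[of 1 s' 9] refl refl, of "3 * N + 7"] by simp
  qed simp_all
  have row: "transfers (for_tm 8 (if_tm 11 Sym_0 (copy_token_tm 9 1) (zero_tm 1))) s' 9 1
      (cat cB (\<lambda>j. if l = k then xB i j else [])) (cat cB (\<lambda>j. if l = k then xB i j else encode_rat 0))
      (loop_time N (3 * N + 8))"
    if "s' 11 = at_pos (marked rW k) l" "l < rW" "i < rB" "s' 8 = ([0], replicate cB Sym_1)" for s' i l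
    by (rule transfers_for[where w = "replicate cB Sym_1", OF _ _ _ _ _ _ _ _ entry])
       (use that lengths in simp_all)
  have rows: "transfers (for_tm 11 (for_tm 8 (if_tm 11 Sym_0 (copy_token_tm 9 1) (zero_tm 1)))) s' 9 1
      (cat rW (\<lambda>l. cat cB (\<lambda>j. if l = k then xB i j else [])))
      (cat rW (\<lambda>l. cat cB (\<lambda>j. if l = k then xB i j else encode_rat 0)))
      (loop_time N (loop_time N (3 * N + 8)))"
    if "s' 11 = ([0], marked rW k)" "i < rB" "s' 8 = ([0], replicate cB Sym_1)" for s' i
    by (rule transfers_for[where w = "marked rW k", OF _ _ _ _ _ _ _ _ row])
       (use that lengths k in simp_all)
  have "cat rW (\<lambda>l. cat cB (\<lambda>j. if l = k then xB i j else [])) = cat cB (xB i)" for i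
  proof -
    have "cat rW (\<lambda>l. cat cB (\<lambda>j. if l = k then xB i j else [])) = cat rW (\<lambda>l. if l = k then cat cB (xB i) else [])"
      by (intro cat_cong) simp
    then show ?thesis using k by (simp add: cat_single)
  qed
  note rows' = rows[unfolded this]
  show ?thesis
    by (rule transfers_for[where w = "replicate rB Sym_1", OF _ _ _ _ _ _ _ _ rows'])
       (use s lengths in simp_all)
qed

text \<open>In contrast to B, every matrix of T is read completely: an entry outside row
  \<open>k\<close> is skipped and replaced by zero, so each round uses up the whole list of
  entries.\<close>

lemma transfers_T_block:
  assumes s: "s 4 = ([0], replicate cA Sym_1)" "s 8 = ([0], replicate cB Sym_1)" "s 11 = ([0], marked rW k)"
    and k: "k < rW"
  shows "transfers (for_tm 8 (dim_tm 11 1 ;; dim_tm 4 1 ;;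
       for_tm 11 (for_tm 4 (if_tm 11 Sym_0 (copy_token_tm 14 1) (skip_token_tm 14 ;; zero_tm 1))))) s 14 1
    (cat cB (\<lambda>l. grid rW cA (xT l)))
    (cat cB (\<lambda>l. encode_dim rW @ encode_dim cA @
      cat rW (\<lambda>i. cat cA (\<lambda>j. if i = k then xT l i j else encode_rat 0))))
    (loop_time N (loop_time N 1 + 1 + (loop_time N 1 + 1 + loop_time N (loop_time N (3 * N + 8)))))"
proof -
  let ?E = "if_tm 11 Sym_0 (copy_token_tm 14 1) (skip_token_tm 14 ;; zero_tm 1)"
  have entry: "transfers ?E s' 14 1 (xT l i j) (if i = k then xT l i j else encode_rat 0) (3 * N + 8)"
    if "s' 11 = at_pos (marked rW k) i" "l < cB" "i < rW" "j < cA" for s' i j l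
  proof (rule transfers_cong[OF transfers_if[where t = "3 * N + 7"]])
    assume "scan (s' 11) = Sym_0"
    then have "i = k" using that k by (simp add: scan_at_pos nth_marked split: if_splits)
    then show "transfers (copy_token_tm 14 1) s' 14 1 (xT l i j) (if i = k then xT l i j else encode_rat 0) (3 * N + 7)"
      using transfers_cong[OF transfers_token[of 14 1 "xT l i j" N s'] refl refl, of "3 * N + 7"] tokens entry_lengths that by simp
  next
    assume "scan (s' 11) \<noteq> Sym_0"
    then have "i \<noteq> k" using that k by (simp add: scan_at_pos nth_marked split: if_splits)
    moreover have skip: "transfers (skip_token_tm 14) s' 14 1 (xT l i j) [] (2 * N + 2)"
      by (rule transfers_skip) (use tokens entry_lengths that in simp_all)
    ultimately show "transfers (skip_token_tm 14 ;; zero_tm 1) s' 14 1 (xT l i j) (if i = k then xT l i j else encode_rat 0) (3 * N + 7)"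
      by (intro transfers_cong[OF transfers_seq[OF _ _ skip transfers_zero[of 1]]]) simp_all
  qed simp_all
  have row: "transfers (for_tm 4 ?E) s' 14 1 (cat cA (xT l i)) (cat cA (\<lambda>j. if i = k then xT l i j else encode_rat 0))
      (loop_time N (3 * N + 8))"
    if "s' 11 = at_pos (marked rW k) i" "l < cB" "i < rW" "s' 4 = ([0], replicate cA Sym_1)" for s' i l
    by (rule transfers_for[where w = "replicate cA Sym_1", OF _ _ _ _ _ _ _ _ entry])
       (use that lengths in simp_all)
  have rows: "transfers (for_tm 11 (for_tm 4 ?E)) s' 14 1 (grid rW cA (xT l))
      (cat rW (\<lambda>i. cat cA (\<lambda>j. if i = k then xT l i j else encode_rat 0))) (loop_time N (loop_time N (3 * N + 8)))"
    if "s' 11 = ([0], marked rW k)" "l < cB" "s' 4 = ([0], replicate cA Sym_1)" for s' l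
    by (rule transfers_for[where w = "marked rW k", OF _ _ _ _ _ _ _ _ row])
       (use that lengths k in simp_all)
  have body: "transfers (dim_tm 11 1 ;; dim_tm 4 1 ;; for_tm 11 (for_tm 4 ?E)) s' 14 1 (grid rW cA (xT l))
      (encode_dim rW @ encode_dim cA @ cat rW (\<lambda>i. cat cA (\<lambda>j. if i = k then xT l i j else encode_rat 0)))
      (loop_time N 1 + 1 + (loop_time N 1 + 1 + loop_time N (loop_time N (3 * N + 8))))"
    if "s' 11 = ([0], marked rW k)" "l < cB" "s' 4 = ([0], replicate cA Sym_1)" for s' l
  proof -
    have 1: "transfers (dim_tm 11 1) s' 14 1 [] (encode_dim rW) (loop_time N 1 + 1)"
      by (rule transfers_dim[where w = "marked rW k"]) (use that lengths k in simp_all)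
    have 2: "transfers (dim_tm 4 1) s' 14 1 [] (encode_dim cA) (loop_time N 1 + 1)"
      by (rule transfers_dim[where w = "replicate cA Sym_1"]) (use that lengths in simp_all)
    show ?thesis using transfers_seq[OF _ _ 1 transfers_seq[OF _ _ 2 rows[OF that]]] by simp
  qed
  show ?thesis
    by (rule transfers_for[where w = "replicate cB Sym_1", OF _ _ _ _ _ _ _ _ body])
       (use s lengths in simp_all)
qed

lemma transfers_from_content:
  assumes "is_program M" "2 \<le> e" "e < 15" "s e = ([0], contents e)"
    and "\<And>z. transfers M (s(0 := z)) e 1 (contents e) v t"
  shows "transfers (from_tm e M) s 0 1 [] v (t + 2 * N + 3)"
  by (rule transfers_from) (use assms zero_notin_contents length_contents in simp_all)

lemma store_contents:
  "store 15 2 = ([0], xR)" "store 15 3 = ([0], replicate rA Sym_1)" "store 15 4 = ([0], replicate cA Sym_1)"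
  "store 15 7 = ([0], replicate rB Sym_1)" "store 15 8 = ([0], replicate cB Sym_1)"
  "store 15 11 = ([0], replicate rW Sym_1)" "store 15 12 = ([0], replicate cW Sym_1)"
  by (simp_all add: store_def contents_def)

lemma transfers_write_program:
  "transfers write_program (store 15) 0 1 [] result (write_time N)"
proof -
  let ?s = "store 15"
  have dim: "transfers (dim_tm c 1) ?s 0 1 [] (encode_dim n) (loop_time N 1 + 1)"
    if "?s c = ([0], replicate n Sym_1)" "n < N" "1 < c" "c < 15" for c n
    by (rule transfers_dim[where w = "replicate n Sym_1"]) (use that in simp_all)
  have dim2: "transfers (dim_mult_tm c d 1) ?s 0 1 [] (encode_dim (m * n)) (loop_time N (loop_time N 1) + 1)"
    if "?s c = ([0], replicate m Sym_1)" "m < N" "?s d = ([0], replicate n Sym_1)" "n < N"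
      "1 < c" "c < 15" "1 < d" "d < 15" "c \<noteq> d" for c d m n
    by (rule transfers_dim_mult[where w = "replicate m Sym_1" and w' = "replicate n Sym_1"]) (use that in simp_all)
  note dims = store_contents lengths
  have R: "transfers (from_tm 2 (copy_token_tm 2 1)) ?s 0 1 [] xR (3 * N + 3 + 2 * N + 3)"
    by (rule transfers_from_content)
       (use tokens lengths in \<open>simp_all add: store_def contents_def transfers_token\<close>)
  have grid: "transfers (from_tm e (for_tm c (for_tm d (copy_token_tm e 1)))) ?s 0 1 [] (grid m n x)
      (loop_time N (loop_time N (3 * N + 3)) + 2 * N + 3)"
    if "?s c = ([0], replicate m Sym_1)" "m < N" "?s d = ([0], replicate n Sym_1)" "n < N"
      "1 < c" "c < 15" "1 < d" "d < 15" "c \<noteq> d" "c \<noteq> e" "d \<noteq> e" "2 \<le> e" "e < 15"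
      "contents e = grid m n x" "\<And>i j. is_token (x i j)" "\<And>i j. i < m \<Longrightarrow> j < n \<Longrightarrow> length (x i j) \<le> N" for c d e m n x
  proof (rule transfers_from_content)
    show "transfers (for_tm c (for_tm d (copy_token_tm e 1))) (?s(0 := z)) e 1 (contents e) (grid m n x)
        (loop_time N (loop_time N (3 * N + 3)))" for z
      unfolding that(14)
      by (rule transfers_grid[where w = "replicate m Sym_1" and w' = "replicate n Sym_1"]) (use that in simp_all)
  qed (use that in \<open>simp_all add: store_def\<close>)
  have toks: "transfers (from_tm e (for_tm c (copy_token_tm e 1))) s 0 1 [] (cat n x)
      (loop_time N (3 * N + 3) + 2 * N + 3)"
    if "s c = ([0], replicate n Sym_1)" "n < N" "1 < c" "c < 15" "c \<noteq> e" "2 \<le> e" "e < 15" "s e = ([0], contents e)"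
      "contents e = cat n x" "\<And>i. is_token (x i)" "\<And>i. i < n \<Longrightarrow> length (x i) \<le> N" for s c e n x
  proof (rule transfers_from_content)
    show "transfers (for_tm c (copy_token_tm e 1)) (s(0 := z)) e 1 (contents e) (cat n x)
        (loop_time N (3 * N + 3))" for z
      unfolding that(9)
      by (rule transfers_tokens[where w = "replicate n Sym_1"]) (use that in simp_all)
  qed (use that in simp_all)
  have A: "transfers (from_tm 5 (for_tm 3 (for_tm 4 (copy_token_tm 5 1)))) ?s 0 1 [] (grid rA cA xA)
      (loop_time N (loop_time N (3 * N + 3)) + 2 * N + 3)"
    by (rule grid) (use dims tokens entry_lengths in \<open>simp_all add: contents_def\<close>)
  have a: "transfers (from_tm 6 (for_tm 3 (copy_token_tm 6 1))) ?s 0 1 [] (cat rA xa) (loop_time N (3 * N + 3) + 2 * N + 3)"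
    by (rule toks) (use dims tokens entry_lengths in \<open>simp_all add: contents_def store_def\<close>)
  have W: "transfers (from_tm 13 (for_tm 11 (for_tm 12 (copy_token_tm 13 1)))) ?s 0 1 [] (grid rW cW xW)
      (loop_time N (loop_time N (3 * N + 3)) + 2 * N + 3)"
    by (rule grid) (use dims tokens entry_lengths in \<open>simp_all add: contents_def\<close>)
  \<comment> \<open>Tape 11 is arbitrary here because its head moves through the counter while the
    enclosing loop repeats this body.\<close>
  have b': "transfers (from_tm 10 (for_tm 7 (copy_token_tm 10 1))) (?s(11 := z)) 0 1 [] (cat rB xb)
      (loop_time N (3 * N + 3) + 2 * N + 3)" for z
  proof (rule toks)
    show "(?s(11 := z)) 7 = ([0], replicate rB Sym_1)" by (simp add: store_contents)
    show "(?s(11 := z)) 10 = ([0], contents 10)" by (simp add: store_simps)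
    show "contents 10 = cat rB xb" by (simp add: contents_def)
  qed (use lengths tokens entry_lengths in simp_all)
  have b: "transfers (for_tm 11 (from_tm 10 (for_tm 7 (copy_token_tm 10 1)))) ?s 0 1 (cat rW (\<lambda>_. [])) (cat rW (\<lambda>_. cat rB xb))
      (loop_time N (loop_time N (3 * N + 3) + 2 * N + 3))"
    by (rule transfers_for[where w = "replicate rW Sym_1", OF _ _ _ _ _ _ _ _ b']) (use dims in simp_all)
  let ?B = "for_tm 7 (for_tm 11 (for_tm 8 (if_tm 11 Sym_0 (copy_token_tm 9 1) (zero_tm 1))))"
  have B': "transfers (from_tm 9 ?B) (?s(11 := ([0], marked rW k))) 0 1 []
      (cat rB (\<lambda>i. cat rW (\<lambda>l. cat cB (\<lambda>j. if l = k then xB i j else encode_rat 0))))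
      (loop_time N (loop_time N (loop_time N (3 * N + 8))) + 2 * N + 3)" if "k < rW" for k
  proof (rule transfers_from_content)
    have "contents 9 = grid rB cB xB" by (simp add: contents_def)
    then show "transfers ?B (?s(11 := ([0], marked rW k), 0 := z)) 9 1 (contents 9)
        (cat rB (\<lambda>i. cat rW (\<lambda>l. cat cB (\<lambda>j. if l = k then xB i j else encode_rat 0))))
        (loop_time N (loop_time N (loop_time N (3 * N + 8))))" for z
      using transfers_B_block[of "?s(11 := ([0], marked rW k), 0 := z)" k] that dims by simp
  qed (simp_all add: store_def)
  have B: "transfers (mark_each_tm 11 (from_tm 9 ?B)) ?s 0 1 (cat rW (\<lambda>_. []))
      (cat rW (\<lambda>k. cat rB (\<lambda>i. cat rW (\<lambda>l. cat cB (\<lambda>j. if l = k then xB i j else encode_rat 0)))))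
      (mark_time N (loop_time N (loop_time N (loop_time N (3 * N + 8))) + 2 * N + 3))"
    by (rule transfers_mark_each[OF _ _ _ _ _ _ B']) (use dims in simp_all)
  let ?T = "for_tm 8 (dim_tm 11 1 ;; dim_tm 4 1 ;;
       for_tm 11 (for_tm 4 (if_tm 11 Sym_0 (copy_token_tm 14 1) (skip_token_tm 14 ;; zero_tm 1))))"
  have T': "transfers (from_tm 14 ?T) (?s(11 := ([0], marked rW k))) 0 1 []
      (cat cB (\<lambda>l. encode_dim rW @ encode_dim cA @
        cat rW (\<lambda>i. cat cA (\<lambda>j. if i = k then xT l i j else encode_rat 0))))
      (loop_time N (loop_time N 1 + 1 + (loop_time N 1 + 1 + loop_time N (loop_time N (3 * N + 8)))) + 2 * N + 3)"
    if "k < rW" for k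
  proof (rule transfers_from_content)
    have "contents 14 = cat cB (\<lambda>l. grid rW cA (xT l))" by (simp add: contents_def)
    then show "transfers ?T (?s(11 := ([0], marked rW k), 0 := z)) 14 1 (contents 14)
        (cat cB (\<lambda>l. encode_dim rW @ encode_dim cA @
          cat rW (\<lambda>i. cat cA (\<lambda>j. if i = k then xT l i j else encode_rat 0))))
        (loop_time N (loop_time N 1 + 1 + (loop_time N 1 + 1 + loop_time N (loop_time N (3 * N + 8)))))" for z
      using transfers_T_block[of "?s(11 := ([0], marked rW k), 0 := z)" k] that dims by simp
  qed (simp_all add: store_def)
  have T: "transfers (mark_each_tm 11 (from_tm 14 ?T)) ?s 0 1 (cat rW (\<lambda>_. []))
      (cat rW (\<lambda>k. cat cB (\<lambda>l. encode_dim rW @ encode_dim cA @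
        cat rW (\<lambda>i. cat cA (\<lambda>j. if i = k then xT l i j else encode_rat 0)))))
      (mark_time N (loop_time N (loop_time N 1 + 1 + (loop_time N 1 + 1 + loop_time N (loop_time N (3 * N + 8)))) + 2 * N + 3))"
    by (rule transfers_mark_each[OF _ _ _ _ _ _ T']) (use dims in simp_all)
  note d = dim[OF dims(2)] dim[OF dims(3)] dim[OF dims(6)] dim[OF dims(7)]
  \<comment> \<open>No piece reads tape 0. The input is spelled out piece by piece, with
    concatenations of empty words for the loops, so that it matches the composition rule.\<close>
  have "transfers write_program ?s 0 1
    ([] @ [] @ [] @ [] @ [] @ [] @ [] @ [] @ cat rW (\<lambda>_. []) @ [] @ cat rW (\<lambda>_. []) @ [] @ [] @ [] @ [] @ cat rW (\<lambda>_. []))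
    result (write_time N)"
    unfolding write_program_def write_time_def Let_def result_def
    by (intro transfers_seq[OF _ _ R] transfers_seq[OF _ _ d(1)] transfers_seq[OF _ _ d(2)]
        transfers_seq[OF _ _ A] transfers_seq[OF _ _ a]
        transfers_seq[OF _ _ dim2[OF dims(6) _ dims(4)]] transfers_seq[OF _ _ dim2[OF dims(6) _ dims(5)]]
        transfers_seq[OF _ _ B] transfers_seq[OF _ _ b] transfers_seq[OF _ _ d(3)]
        transfers_seq[OF _ _ d(4)] transfers_seq[OF _ _ W] T) (use dims in simp_all)
  then show ?thesis by simp
qed

lemma runs_programs:
  "runs (load_program ;; write_program) ((\<lambda>_. ([], []))(0 := ([], input))) (load_time N + write_time N)
     ((store 15)(0 := (rev input, []), 1 := (rev result, [])))"
proof (rule runs_seq)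
  have "store 2 = (\<lambda>_. ([], []))" by (simp add: store_def fun_eq_iff)
  then show "runs load_program ((\<lambda>_. ([], []))(0 := ([], input))) (load_time N) ((store 15)(0 := (rev input, [])))"
    using loads_load_program[unfolded loads_def, rule_format, of "[]" "[]"] by simp
  have "store 15 1 = ([], [])" by (simp add: store_def)
  then show "runs write_program ((store 15)(0 := (rev input, []))) (write_time N)
      ((store 15)(0 := (rev input, []), 1 := (rev result, [])))"
    using transfers_write_program[unfolded transfers_def, rule_format, of "rev input" "[]" "[]"]
    by (simp add: fun_upd_idem)
qed simp_all

end

section \<open>Polynomial time\<close>

text \<open>Equality instead of a bound is enough, because the time bounds are built from constants
  and the argument by sums and products alone.\<close>

definition poly_fun :: "(nat \<Rightarrow> nat) \<Rightarrow> bool" where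
  "poly_fun f \<longleftrightarrow> (\<exists>p :: nat poly. \<forall>n. f n = poly p n)"

lemma poly_fun_intros:
  "poly_fun (\<lambda>_. c)" "poly_fun (\<lambda>n. n)"
  "poly_fun f \<Longrightarrow> poly_fun g \<Longrightarrow> poly_fun (\<lambda>n. f n + g n)"
  "poly_fun f \<Longrightarrow> poly_fun g \<Longrightarrow> poly_fun (\<lambda>n. f n * g n)"
proof -
  show "poly_fun (\<lambda>_. c)" unfolding poly_fun_def by (intro exI[of _ "[:c:]"]) simp
  show "poly_fun (\<lambda>n. n)" unfolding poly_fun_def by (intro exI[of _ "[:0, 1:]"]) simp
  show "poly_fun f \<Longrightarrow> poly_fun g \<Longrightarrow> poly_fun (\<lambda>n. f n + g n)"
    unfolding poly_fun_def by (metis poly_add)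
  show "poly_fun f \<Longrightarrow> poly_fun g \<Longrightarrow> poly_fun (\<lambda>n. f n * g n)"
    unfolding poly_fun_def by (metis poly_mult)
qed

lemma poly_fun_time: "poly_fun (\<lambda>n. load_time n + write_time n)"
  unfolding load_time_def write_time_def loop_time_def mark_time_def Let_def by (intro poly_fun_intros)

lemma split_rows_computable:
  assumes wf: "wf_instance I"
  defines "N \<equiv> length (encode_instance I)"
  shows "tm_computes (load_program ;; write_program) (encode_instance I) (encode_instance (split_rows I))
    (load_time N + write_time N)"
proof -
  interpret input_tokens N "encode_nat (R_bound I) @ [Sym_end]" "dim_row (A_mat I)" "n_x I" "dim_row (B_mat I)"
    "n_u I" "m_y I" "n_y I" "\<lambda>i j. encode_rat (A_mat I $$ (i, j))" "\<lambda>i j. encode_rat (B_mat I $$ (i, j))"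
    "\<lambda>i j. encode_rat (W_mat I $$ (i, j))" "\<lambda>i. encode_rat (a_vec I $ i)" "\<lambda>i. encode_rat (b_vec I $ i)"
    "\<lambda>k i j. encode_rat (T_mats I ! k $$ (i, j))" "encode_instance I"
  proof
    show "encode_instance I = (encode_nat (R_bound I) @ [Sym_end]) @
      encode_dim (dim_row (A_mat I)) @ encode_dim (n_x I) @
      cat (dim_row (A_mat I)) (\<lambda>i. cat (n_x I) (\<lambda>j. encode_rat (A_mat I $$ (i, j)))) @
      encode_dim (dim_row (A_mat I)) @ cat (dim_row (A_mat I)) (\<lambda>i. encode_rat (a_vec I $ i)) @
      encode_dim (dim_row (B_mat I)) @ encode_dim (n_u I) @
      cat (dim_row (B_mat I)) (\<lambda>i. cat (n_u I) (\<lambda>j. encode_rat (B_mat I $$ (i, j)))) @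
      encode_dim (dim_row (B_mat I)) @ cat (dim_row (B_mat I)) (\<lambda>i. encode_rat (b_vec I $ i)) @
      encode_dim (m_y I) @ encode_dim (n_y I) @
      cat (m_y I) (\<lambda>i. cat (n_y I) (\<lambda>j. encode_rat (W_mat I $$ (i, j)))) @
      encode_dim (n_u I) @
      cat (n_u I) (\<lambda>k. encode_dim (m_y I) @ encode_dim (n_x I) @
        cat (m_y I) (\<lambda>i. cat (n_x I) (\<lambda>j. encode_rat (T_mats I ! k $$ (i, j)))))"
      by (rule encode_instance_cat[OF wf])
  qed (simp_all only: is_token_encode_nat is_token_encode_rat N_def order_refl)
  have out: "encode_instance (split_rows I) = result"
    unfolding result_def by (rule encode_split_rows[OF wf])
  let ?M = "load_program ;; write_program"
  let ?s = "(\<lambda>_. ([], []))(0 := ([], encode_instance I))"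
  have M: "tapes ?M = tape_num" "symbols ?M = sym_num" by (simp_all add: seq_tm_def)
  have init: "initial_config ?M (encode_instance I) = (0, tapes_of ?s)"
  proof -
    have "[0..<tape_num] = 0 # [1..<tape_num]" unfolding tape_num_def by (subst upt_conv_Cons) simp_all
    moreover have "map (\<lambda>i. tape_of (?s i)) [1..<tape_num] = replicate (tape_num - 1) (\<lambda>_. 0, 0)"
      by (rule nth_equalityI) (simp_all add: tape_of_def word_contents_def fun_eq_iff)
    ultimately show ?thesis
      by (simp add: initial_config_def M tapes_of_def tape_of_def)
  qed
  have "fst (tapes_of (s(1 := (rev result, []))) ! 1) = word_contents result" for s
    by (simp add: tapes_of_def tape_of_def)
  then show ?thesis
    unfolding tm_computes_def M init out
    using runs_programs set_encode_instance[of I] set_encode_instance[of "split_rows I"]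
    unfolding runs_def out by blast
qed

theorem theorem1:
  fixes K :: "adapt_instance \<Rightarrow> nat" and cX cU cY :: var_type
  assumes "\<And>I. wf_instance I \<Longrightarrow> 1 \<le> K I"
    and "polynomial_in_input K"
  shows "bounded_adaptability (\<lambda>_. 1) cX cU cY \<le>\<^sub>p bounded_adaptability K cX cU cY"
proof -
  obtain p where p: "\<And>n. load_time n + write_time n = poly p n"
    using poly_fun_time unfolding poly_fun_def by blast
  \<comment> \<open>The number of policies is read off the image instance, so the bound
    \<open>1 \<le> K\<close> is used there, which requires the image to be well-formed.\<close>
  have "K_adaptable cX cU cY 1 I \<longleftrightarrow> K_adaptable cX cU cY (K (split_rows I)) (split_rows I)" if "wf_instance I" for I
    using K_adaptable_split_rowsI K_adaptable_split_rowsD assms(1)[OF wf_split_rows] that by blast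
  then show ?thesis
    unfolding poly_time_reducible_def bounded_adaptability_def
    using wf_split_rows split_rows_computable[unfolded p]
    by (intro exI[of _ split_rows] exI[of _ "load_program ;; write_program"] exI[of _ p])
       (simp add: wf_tm_program)
qed

end
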